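(* Let $\mathbf A=(a_{ij})\in\mathbb H^{m\times n}$ have rank $r\ge 1$, and let $\mathbf A^{+}=(a^{+}_{ij})\in\mathbb H^{n\times m}$ be its Moore–Penrose inverse. Then for all $i=1,\dots,n$ and $j=1,\dots,m$, \[ a_{ij}^{+}=\frac{\sum_{\beta\in J_{r,n}\{i\}}\operatorname{cdet}_i\Big(\big((\mathbf A^{*}\mathbf A)_{.i}(\mathbf a^{*}_{.j})\big)^{\beta}_{\beta}\Big)}{\sum_{\beta\in J_{r,n}}\big|(\mathbf A^{*}\mathbf A)^{\beta}_{\beta}\big|} \] and also \[ a_{ij}^{+}=\frac{\sum_{\alpha\in I_{r,m}\{j\}}\operatorname{rdet}_j\Big(\big((\mathbf A\mathbf A^{*})_{j.}(\mathbf a^{*}_{i.})\big)^{\alpha}_{\alpha}\Big)}{\sum_{\alpha\in I_{r,m}}\big|(\mathbf A\mathbf A^{*})^{\alpha}_{\alpha}\big|}. \]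
   Context: $\mathbb H$ is the quaternion skew field; $\bar a$ is the quaternion conjugate and $\mathbf A^{*}=(\overline{a_{ji}})$ is the conjugate transpose. The rank of a quaternion matrix is the maximal number of right-linearly independent columns (equivalently, of left-linearly independent rows). The Moore–Penrose inverse of $\mathbf A\in\mathbb H^{m\times n}$ is the unique $\mathbf X\in\mathbb H^{n\times m}$ with $\mathbf A\mathbf X\mathbf A=\mathbf A$, $\mathbf X\mathbf A\mathbf X=\mathbf X$, $(\mathbf A\mathbf X)^*=\mathbf A\mathbf X$, $(\mathbf X\mathbf A)^*=\mathbf X\mathbf A$. Row and column determinants of $\mathbf M=(m_{ij})\in\mathbb H^{n\times n}$: for $i\in\{1,\dots,n\}$, $\operatorname{rdet}_i\mathbf M=\sum_{\sigma\in S_n}(-1)^{n-r}m_{i\,i_{k_1}}m_{i_{k_1}i_{k_1+1}}\cdots m_{i_{k_1+l_1}\,i}\cdots m_{i_{k_r}i_{k_r+1}}\cdots m_{i_{k_r+l_r}i_{k_r}}$, where $\sigma$ is written as a product of $r$ disjoint cycles (fixed points included) $\sigma=(i\,i_{k_1}\,i_{k_1+1}\dots i_{k_1+l_1})(i_{k_2}\dots i_{k_2+l_2})\cdots(i_{k_r}\dots i_{k_r+l_r})$, the first cycle starting with $i$, each other cycle starting with its smallest element, and $i_{k_2}<i_{k_3}<\dots<i_{k_r}$. For $j\in\{1,\dots,n\}$, $\operatorname{cdet}_j\mathbf M=\sum_{\tau\in S_n}(-1)^{n-r}m_{j_{k_r}j_{k_r+l_r}}\cdots m_{j_{k_r+1}j_{k_r}}\cdots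 m_{j\,j_{k_1+l_1}}\cdots m_{j_{k_1+1}j_{k_1}}m_{j_{k_1}j}$, where $\tau=(j_{k_r+l_r}\dots j_{k_r+1}j_{k_r})\cdots(j_{k_2+l_2}\dots j_{k_2+1}j_{k_2})(j_{k_1+l_1}\dots j_{k_1+1}j_{k_1}\,j)$ is written as a product of $r$ disjoint cycles, the rightmost cycle ending with $j$, each other cycle ending (on the right) with its smallest element, and $j_{k_2}<\dots<j_{k_r}$. For a Hermitian matrix ($\mathbf M^*=\mathbf M$) all $\operatorname{rdet}_i\mathbf M$ and $\operatorname{cdet}_j\mathbf M$ coincide and are real; their common value is denoted $\det\mathbf M$. Notation: $\mathbf a_{.j}$ is the $j$th column and $\mathbf a_{i.}$ the $i$th row of $\mathbf A$; $\mathbf a^{*}_{.j}$, $\mathbf a^{*}_{i.}$ are the $j$th column and $i$th row of $\mathbf A^{*}$. $\mathbf M_{.i}(\mathbf b)$ is $\mathbf M$ with its $i$th column replaced by the column $\mathbf b$; $\mathbf M_{j.}(\mathbf b)$ is $\mathbf M$ with its $j$th row replaced by the row $\mathbf b$. $L_{k,n}$ is the set of strictly increasing sequences $\beta=(\beta_1<\dots<\beta_k)$ from $\{1,\dots,n\}$; $J_{k,n}\{i\}=\{\beta\in L_{k,n}: i\in\beta\}$ and $I_{k,m}\{j\}=\{\alpha\in L_{k,m}:j\in\alpha\}$; $J_{k,n}=L_{k,n}$, $I_{k,m}=L_{k,m}$. For $\beta$, $\mathbf M^{\beta}_{\beta}$ is the principal submatrix with rows and columns indexed by $\beta$; for Hermitian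 $\mathbf M$, $|\mathbf M^{\beta}_{\beta}|=\det\mathbf M^{\beta}_{\beta}$ is a principal minor. In $\operatorname{cdet}_i(\mathbf N^{\beta}_{\beta})$ with $i\in\beta$, the subscript $i$ refers to the column of the submatrix coming from column $i$ of $\mathbf N$ (similarly for $\operatorname{rdet}_j$ and rows). *)

theory Defs
  imports Complex_Main "HOL-Combinatorics.Permutations"
begin

datatype quat = Quat (qr: real) (qi: real) (qj: real) (qk: real)

instantiation quat :: ring_1
begin
definition zero_quat_def: "0 = Quat 0 0 0 0"
definition one_quat_def: "1 = Quat 1 0 0 0"
definition plus_quat_def: "x + y = Quat (qr x + qr y) (qi x + qi y) (qj x + qj y) (qk x + qk y)"
definition uminus_quat_def: "- x = Quat (- qr x) (- qi x) (- qj x) (- qk x)"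
definition minus_quat_def: "x - y = Quat (qr x - qr y) (qi x - qi y) (qj x - qj y) (qk x - qk y)"
definition times_quat_def: "x * y = Quat
   (qr x * qr y - qi x * qi y - qj x * qj y - qk x * qk y)
   (qr x * qi y + qi x * qr y + qj x * qk y - qk x * qj y)
   (qr x * qj y - qi x * qk y + qj x * qr y + qk x * qi y)
   (qr x * qk y + qi x * qj y - qj x * qi y + qk x * qr y)"
instance
  by intro_classes
     (auto simp: zero_quat_def one_quat_def plus_quat_def uminus_quat_def
                 minus_quat_def times_quat_def quat.expand algebra_simps)
end

text \<open>Quaternion conjugate and inverse (inverse of 0 is 0).\<close>
definition qcnj :: "quat \<Rightarrow> quat" where
  "qcnj x = Quat (qr x) (- qi x) (- qj x) (- qk x)"

definition qinv :: "quat \<Rightarrow> quat" where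
  "qinv x = (let s = (qr x)^2 + (qi x)^2 + (qj x)^2 + (qk x)^2 in
             Quat (qr x / s) (- qi x / s) (- qj x / s) (- qk x / s))"

text \<open>An m x n matrix is a function nat => nat => quat; only entries with row index < m
  and column index < n are meaningful. Indices are 0-based.\<close>

type_synonym qmat = "nat \<Rightarrow> nat \<Rightarrow> quat"

definition qmmul :: "nat \<Rightarrow> qmat \<Rightarrow> qmat \<Rightarrow> qmat" where
  "qmmul k A B = (\<lambda>i j. \<Sum>l<k. A i l * B l j)"

definition qct :: "qmat \<Rightarrow> qmat" where
  "qct A = (\<lambda>i j. qcnj (A j i))"

definition is_MP_inverse :: "nat \<Rightarrow> nat \<Rightarrow> qmat \<Rightarrow> qmat \<Rightarrow> bool" where
  "is_MP_inverse m n A X \<longleftrightarrow>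
     (\<forall>i<m. \<forall>j<n. qmmul m (qmmul n A X) A i j = A i j) \<and>
     (\<forall>i<n. \<forall>j<m. qmmul n (qmmul m X A) X i j = X i j) \<and>
     (\<forall>i<m. \<forall>j<m. qct (qmmul n A X) i j = qmmul n A X i j) \<and>
     (\<forall>i<n. \<forall>j<n. qct (qmmul m X A) i j = qmmul m X A i j)"

definition right_indep_cols :: "nat \<Rightarrow> qmat \<Rightarrow> nat set \<Rightarrow> bool" where
  "right_indep_cols m A S \<longleftrightarrow>
     (\<forall>w :: nat \<Rightarrow> quat. (\<forall>r<m. (\<Sum>c\<in>S. A r c * w c) = 0) \<longrightarrow> (\<forall>c\<in>S. w c = 0))"

definition qrank :: "nat \<Rightarrow> nat \<Rightarrow> qmat \<Rightarrow> nat" where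
  "qrank m n A = Max {card S | S. S \<subseteq> {..<n} \<and> right_indep_cols m A S}"

definition qprod_list :: "quat list \<Rightarrow> quat" where
  "qprod_list xs = foldr (*) xs 1"

definition orb :: "(nat \<Rightarrow> nat) \<Rightarrow> nat \<Rightarrow> nat set" where
  "orb \<sigma> s = {(\<sigma> ^^ t) s | t. True}"

definition cyc_prod :: "qmat \<Rightarrow> (nat \<Rightarrow> nat) \<Rightarrow> nat \<Rightarrow> quat" where
  "cyc_prod M \<sigma> s =
     qprod_list (map (\<lambda>t. M ((\<sigma> ^^ t) s) ((\<sigma> ^^ Suc t) s)) [0..<card (orb \<sigma> s)])"

definition cyc_reps :: "nat set \<Rightarrow> (nat \<Rightarrow> nat) \<Rightarrow> nat set" where
  "cyc_reps I \<sigma> = {s \<in> I. s = Min (orb \<sigma> s)}"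

text \<open>Row determinant rdet_i of the square matrix M with rows and columns indexed by the
  finite set I (ordered as natural numbers), i in I: the cycle of i comes first, starting
  with i; the remaining cycles start with their smallest elements and appear in increasing
  order of those.\<close>
definition rdet_on :: "nat set \<Rightarrow> nat \<Rightarrow> qmat \<Rightarrow> quat" where
  "rdet_on I i M = (\<Sum>\<sigma> | \<sigma> permutes I.
     (-1) ^ (card I - card (cyc_reps I \<sigma>)) *
     (cyc_prod M \<sigma> i *
      qprod_list (map (cyc_prod M \<sigma>)
        (sorted_list_of_set (cyc_reps I \<sigma> - {Min (orb \<sigma> i)})))))"

text \<open>Column determinant cdet_j: the cycle of j comes last (rightmost), ending with j,
  i.e. its factors are m(j, tau j) ... m(tau^l j, j); the other cycles end with their
  smallest elements and appear (left to right) in decreasing order of those.\<close>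
definition cdet_on :: "nat set \<Rightarrow> nat \<Rightarrow> qmat \<Rightarrow> quat" where
  "cdet_on I j M = (\<Sum>\<tau> | \<tau> permutes I.
     (-1) ^ (card I - card (cyc_reps I \<tau>)) *
     (qprod_list (map (cyc_prod M \<tau>)
        (rev (sorted_list_of_set (cyc_reps I \<tau> - {Min (orb \<tau> j)})))) *
      cyc_prod M \<tau> j))"

text \<open>Determinant of a Hermitian matrix (common value of all row/column determinants);
  we take rdet at the least index.\<close>
definition hdet_on :: "nat set \<Rightarrow> qmat \<Rightarrow> quat" where
  "hdet_on I M = rdet_on I (Min I) M"

definition repl_col :: "qmat \<Rightarrow> nat \<Rightarrow> (nat \<Rightarrow> quat) \<Rightarrow> qmat" where
  "repl_col M i b = (\<lambda>r c. if c = i then b r else M r c)"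

definition repl_row :: "qmat \<Rightarrow> nat \<Rightarrow> (nat \<Rightarrow> quat) \<Rightarrow> qmat" where
  "repl_row M j b = (\<lambda>r c. if r = j then b c else M r c)"

end

theory Submission
  imports Defs "HOL-Combinatorics.Cycles"
begin

text \<open>
  Splitting off the cycle through \<open>i\<close> writes \<open>cdet\<^sub>i\<close> as a sum over paths starting in \<open>i\<close>,
  weighted by determinants of the complementary principal submatrices. For a Hermitian matrix,
  reversing a path conjugates its product, so by induction on the index set these determinants
  are real, hence central, and independent of \<open>i\<close>; a sign-reversing matching of walks shows that
  the cofactors annihilate all other columns.

  Let \<open>H = A\<^sup>* A\<close>, let \<open>d\<^sub>k\<close> be the sum of its principal minors of order \<open>k\<close> and \<open>C\<^sub>k\<close> the sum of
  the zero-padded adjugates of its principal submatrices of order \<open>k\<close>. Then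
  \<open>C\<^sub>k H + C\<^sub>k\<^sub>+\<^sub>1 = d\<^sub>k\<close>. Principal minors of \<open>H\<close> are positive or zero according to whether the
  corresponding columns of \<open>A\<close> are independent, so \<open>d\<^sub>k = 0\<close> for \<open>k > r\<close> and \<open>d\<^sub>r > 0\<close>. Descending
  from \<open>k = n + 1\<close> the recurrence gives \<open>C\<^sub>k A\<^sup>* = 0\<close> for \<open>k > r\<close>, and then
  \<open>C\<^sub>r A\<^sup>* = C\<^sub>r H A\<^sup>+ = d\<^sub>r A\<^sup>+ - C\<^sub>r\<^sub>+\<^sub>1 A\<^sup>+ = d\<^sub>r A\<^sup>+\<close>, which is the first formula. The second one is
  the first one for \<open>A\<^sup>*\<close>, conjugated.
\<close>

section \<open>Quaternions\<close>

text \<open>Makes \<open>of_real\<close> available; a determinant written as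
  \<open>of_real d\<close> commutes with every quaternion.\<close>

instantiation quat :: real_algebra_1
begin
definition scaleR_quat_def: "c *\<^sub>R x = Quat (c * qr x) (c * qi x) (c * qj x) (c * qk x)"
instance
  by intro_classes
     (auto simp: scaleR_quat_def zero_quat_def one_quat_def plus_quat_def
        times_quat_def quat.expand algebra_simps)
end

lemma quat_sel [simp]:
  "qr 0 = 0" "qi 0 = 0" "qj 0 = 0" "qk 0 = 0"
  "qr 1 = 1" "qi 1 = 0" "qj 1 = 0" "qk 1 = 0"
  "qr (x + y) = qr x + qr y" "qi (x + y) = qi x + qi y"
  "qj (x + y) = qj x + qj y" "qk (x + y) = qk x + qk y"
  "qr (of_real c) = c" "qi (of_real c) = 0" "qj (of_real c) = 0" "qk (of_real c) = 0"
  by (simp_all add: zero_quat_def one_quat_def plus_quat_def of_real_def scaleR_quat_def)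

lemma qr_of_real_mult [simp]: "qr (of_real c * x) = c * qr x"
  by (simp add: times_quat_def)

lemma of_real_quat_commute: "of_real c * x = x * (of_real c :: quat)"
  by (simp add: times_quat_def quat.expand algebra_simps)

text \<open>The real part behaves like a trace, so a closed walk may be started at another vertex
  without changing its real part.\<close>

lemma qr_mult_commute: "qr (x * y) = qr (y * x)"
  by (simp add: times_quat_def algebra_simps)

lemma qr_sum: "qr (sum f S) = (\<Sum>x\<in>S. qr (f x))"
  by (induction S rule: infinite_finite_induct) simp_all

lemma qcnj_0 [simp]: "qcnj 0 = 0"
  and qcnj_1 [simp]: "qcnj 1 = 1"
  and qcnj_of_real [simp]: "qcnj (of_real c) = of_real c"
  and qcnj_qcnj [simp]: "qcnj (qcnj x) = x"
  and qcnj_add: "qcnj (x + y) = qcnj x + qcnj y"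
  and qcnj_mult: "qcnj (x * y) = qcnj y * qcnj x"
  by (simp_all add: qcnj_def quat.expand plus_quat_def times_quat_def algebra_simps)

lemma qcnj_sum: "qcnj (sum f S) = (\<Sum>x\<in>S. qcnj (f x))"
  by (induction S rule: infinite_finite_induct) (simp_all add: qcnj_add)

lemma qcnj_neg_one_power [simp]: "qcnj ((-1) ^ k) = (-1) ^ k"
  using qcnj_of_real[of "(-1) ^ k"] by simp

lemma qcnj_eq_0_iff [simp]: "qcnj x = 0 \<longleftrightarrow> x = 0"
  by (metis qcnj_0 qcnj_qcnj)

lemma qcnj_fixed_imp_real: "qcnj x = x \<Longrightarrow> x = of_real (qr x)"
  by (cases x) (simp add: qcnj_def of_real_def scaleR_quat_def one_quat_def)

lemma qcnj_mult_self: "qcnj x * x = of_real ((qr x)\<^sup>2 + (qi x)\<^sup>2 + (qj x)\<^sup>2 + (qk x)\<^sup>2)"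
  by (simp add: qcnj_def times_quat_def of_real_def scaleR_quat_def one_quat_def power2_eq_square)

lemma quat_norm_sq_eq_0_iff:
  "(qr x)\<^sup>2 + (qi x)\<^sup>2 + (qj x)\<^sup>2 + (qk x)\<^sup>2 = 0 \<longleftrightarrow> x = 0"
  by (cases x) (auto simp: zero_quat_def add_nonneg_eq_0_iff)

lemma sum_qcnj_mult_self_nonneg: "qr (\<Sum>l\<in>S. qcnj (u l) * u l) \<ge> 0"
  unfolding qr_sum qcnj_mult_self quat_sel by (intro sum_nonneg) simp

lemma sum_qcnj_mult_self_eq_0:
  assumes "finite S" "qr (\<Sum>l\<in>S. qcnj (u l) * u l) = 0" "l \<in> S"
  shows "u l = 0"
  using assms unfolding qr_sum qcnj_mult_self quat_sel
  by (subst (asm) sum_nonneg_eq_0_iff) (auto simp: quat_norm_sq_eq_0_iff)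

text \<open>Registers the skew field, so that cancellation and elimination apply to quaternions and
  \<open>qinv\<close> becomes \<open>inverse\<close>.\<close>

instantiation quat :: division_ring
begin
definition inverse_quat_def: "inverse x = qinv x"
definition divide_quat_def: "x div y = x * qinv (y :: quat)"
instance
proof
  fix x y :: quat
  show "x \<noteq> 0 \<Longrightarrow> inverse x * x = 1" "x \<noteq> 0 \<Longrightarrow> x * inverse x = 1"
    using quat_norm_sq_eq_0_iff[of x]
    by (simp_all add: inverse_quat_def qinv_def Let_def times_quat_def one_quat_def
        flip: add_divide_distrib diff_divide_distrib)
       (simp_all add: field_simps power2_eq_square)
  show "x div y = x * inverse y" by (simp add: divide_quat_def inverse_quat_def)
  show "inverse 0 = (0 :: quat)"
    by (simp add: inverse_quat_def qinv_def zero_quat_def)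
qed
end

instance quat :: real_div_algebra ..

lemma qprod_list_eq_prod_list: "qprod_list = prod_list"
  by (simp add: qprod_list_def prod_list.eq_foldr fun_eq_iff)

lemma qcnj_prod_list: "qcnj (prod_list xs) = prod_list (rev (map qcnj xs))"
  by (induction xs) (simp_all add: qcnj_mult)

section \<open>Matrices\<close>

lemma qmmul_assoc: "qmmul k (qmmul l A B) C = qmmul l A (qmmul k B C)"
  unfolding qmmul_def
  by (rule ext)+ (simp add: sum_distrib_left sum_distrib_right mult.assoc sum.swap[of _ "{..<l}"])

lemma qct_qmmul: "qct (qmmul k A B) = qmmul k (qct B) (qct A)"
  by (simp add: qct_def qmmul_def qcnj_sum qcnj_mult)

lemma qct_qct [simp]: "qct (qct A) = A"
  by (simp add: qct_def)

lemma qmmul_cong: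
  assumes "\<And>l. l < k \<Longrightarrow> A i l = A' i l" "\<And>l. l < k \<Longrightarrow> B l j = B' l j"
  shows "qmmul k A B i j = qmmul k A' B' i j"
  using assms by (simp add: qmmul_def)

section \<open>Expansion of column determinants along a cycle\<close>

text \<open>The last factor is an arbitrary vector \<open>b\<close> at the final vertex: a column of
  \<open>M\<close> closes the walk or leads it to another vertex, a replacement column yields the
  numerators, a unit vector the cofactors.\<close>

fun walk :: "qmat \<Rightarrow> nat \<Rightarrow> nat list \<Rightarrow> (nat \<Rightarrow> quat) \<Rightarrow> quat" where
  "walk M i [] b = b i"
| "walk M i (x # xs) b = M i x * walk M x xs b"

lemma walk_append: "walk M i (xs @ y # ys) b = walk M i xs (\<lambda>r. M r y) * walk M y ys b"
  by (induction xs arbitrary: i) (simp_all add: mult.assoc)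

lemma walk_snoc: "walk M i (xs @ [y]) b = walk M i xs (\<lambda>r. M r y) * b y"
  by (simp add: walk_append)

lemma prod_list_eq_walk:
  "prod_list (map (\<lambda>t. M (c t) (c (Suc t))) [0..<Suc n]) =
    walk M (c 0) (map c [Suc 0..<Suc n]) (\<lambda>r. M r (c (Suc n)))"
proof (induction n)
  case (Suc n)
  have "map c [Suc 0..<Suc (Suc n)] = map c [Suc 0..<Suc n] @ [c (Suc n)]" by simp
  moreover have "[0..<Suc (Suc n)] = [0..<Suc n] @ [Suc n]" by simp
  ultimately show ?case
    using Suc by (simp add: walk_snoc del: upt_Suc)
qed simp

text \<open>The vertices after \<open>i\<close> on a cycle through \<open>i\<close>; fixing the
  start makes the list unique for the cycle.\<close>

definition paths :: "nat set \<Rightarrow> nat \<Rightarrow> nat list set" where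
  "paths I i = {xs. distinct (i # xs) \<and> set xs \<subseteq> I}"

lemma finite_paths: "finite I \<Longrightarrow> finite (paths I i)"
  by (rule finite_subset[OF _ finite_subset_distinct[of I]]) (auto simp: paths_def)

text \<open>The factor left in a column determinant once one cycle is split off. No cycle is singled
  out, so it makes sense on the empty set as well, which is the complement of a full cycle.\<close>

definition cycle_det :: "qmat \<Rightarrow> nat set \<Rightarrow> quat" where
  "cycle_det M J = (\<Sum>\<tau> | \<tau> permutes J. (-1) ^ (card J - card (cyc_reps J \<tau>)) *
     prod_list (map (cyc_prod M \<tau>) (rev (sorted_list_of_set (cyc_reps J \<tau>)))))"

text \<open>The sign is that of a cycle on \<open>length xs + 1\<close> points; \<open>b\<close>
  takes the place of column \<open>i\<close>.\<close>

definition path_det :: "qmat \<Rightarrow> nat set \<Rightarrow> nat \<Rightarrow> (nat \<Rightarrow> quat) \<Rightarrow> quat" where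
  "path_det M I i b = (\<Sum>xs\<in>paths I i. (-1) ^ length xs *
     (cycle_det M (I - insert i (set xs)) * walk M i xs b))"

section \<open>Orbits of a permutation and their cycle products\<close>

lemma orb_eq_support: "permutation \<sigma> \<Longrightarrow> orb \<sigma> s = set (support \<sigma> s)"
  using support_set[of \<sigma> s] by (auto simp: orb_def)

lemma card_orb: "permutation \<sigma> \<Longrightarrow> card (orb \<sigma> s) = least_power \<sigma> s"
  using distinct_card[OF cycle_of_permutation[of \<sigma> s]] orb_eq_support[of \<sigma> s] by simp

lemma support_Cons:
  assumes "permutation \<sigma>"
  shows "support \<sigma> s = s # map (\<lambda>t. (\<sigma> ^^ t) s) [Suc 0..<least_power \<sigma> s]"
  using least_power_of_permutation(2)[OF assms, of s] by (simp add: upt_rec)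

lemma cyc_prod_eq_walk:
  assumes "permutation \<sigma>"
  shows "cyc_prod M \<sigma> s = walk M s (tl (support \<sigma> s)) (\<lambda>r. M r s)"
proof -
  obtain n where n: "least_power \<sigma> s = Suc n"
    using least_power_of_permutation(2)[OF assms, of s] by (cases "least_power \<sigma> s") auto
  have "tl (support \<sigma> s) = map (\<lambda>t. (\<sigma> ^^ t) s) [Suc 0..<Suc n]"
    using support_Cons[OF assms, of s] n by (simp only: list.sel)
  moreover have "(\<sigma> ^^ Suc n) s = s"
    using least_power_of_permutation(1)[OF assms, of s] n by simp
  ultimately show ?thesis
    using prod_list_eq_walk[of M "\<lambda>t. (\<sigma> ^^ t) s" n]
    unfolding cyc_prod_def card_orb[OF assms] qprod_list_eq_prod_list n by (simp del: upt_Suc)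
qed

lemma orb_self: "s \<in> orb \<sigma> s"
  unfolding orb_def by (rule CollectI, rule exI[of _ 0]) simp

lemma orb_subset: "\<sigma> permutes I \<Longrightarrow> s \<in> I \<Longrightarrow> orb \<sigma> s \<subseteq> I"
  unfolding orb_def using permutes_in_image[OF permutes_funpow] by fastforce

lemma orb_eq_or_disjoint:
  assumes "permutation \<sigma>"
  shows "orb \<sigma> s = orb \<sigma> t \<or> orb \<sigma> s \<inter> orb \<sigma> t = {}"
  using disjoint_support[OF assms] unfolding orb_eq_support[OF assms] disjoint_def by blast

lemma finite_cyc_reps [simp]: "finite I \<Longrightarrow> finite (cyc_reps I \<sigma>)"
  by (simp add: cyc_reps_def)

lemma card_cyc_reps_le: "finite I \<Longrightarrow> card (cyc_reps I \<sigma>) \<le> card I"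
  by (rule card_mono) (auto simp: cyc_reps_def)

section \<open>A permutation composed of a cycle through \<open>i\<close> and a permutation of the
  complement\<close>

locale cycle_split =
  fixes I :: "nat set" and i :: nat and xs :: "nat list" and \<tau> \<sigma> :: "nat \<Rightarrow> nat"
  assumes fin: "finite I" and iI: "i \<in> I" and xs: "xs \<in> paths I i"
    and \<tau>: "\<tau> permutes I - insert i (set xs)"
    and \<sigma>_eq: "\<sigma> = cycle_of_list (i # xs) \<circ> \<tau>"
begin

abbreviation "cs \<equiv> i # xs"
abbreviation "J \<equiv> I - insert i (set xs)"

lemma cs: "distinct cs" "set cs \<subseteq> I"
  using xs iI by (auto simp: paths_def)

lemma permutes: "\<sigma> permutes I"
  unfolding \<sigma>_eq
  using permutes_compose[OF permutes_subset[OF \<tau>] permutes_subset[OF cycle_permutes[of cs] cs(2)]]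
  by blast

lemma permutation: "permutation \<sigma>" "permutation \<tau>"
  using permutes \<tau> fin permutation_permutes by (blast, meson finite_Diff)

lemma apply_in: "x \<in> set cs \<Longrightarrow> \<sigma> x = cycle_of_list cs x"
  using permutes_not_in[OF \<tau>, of x] by (auto simp: \<sigma>_eq)

lemma apply_notin: "x \<notin> set cs \<Longrightarrow> \<sigma> x = \<tau> x" "x \<notin> set cs \<Longrightarrow> \<tau> x \<notin> set cs"
proof -
  assume x: "x \<notin> set cs"
  show "\<tau> x \<notin> set cs"
    using x permutes_in_image[OF \<tau>, of x] permutes_not_in[OF \<tau>, of x] by (cases "x \<in> J") auto
  then show "\<sigma> x = \<tau> x" using id_outside_supp[of "\<tau> x" cs] by (simp add: \<sigma>_eq)
qed

lemma funpow_in: "(\<sigma> ^^ t) i = cs ! (t mod length cs)"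
proof -
  have in_cs: "(cycle_of_list cs ^^ t) i \<in> set cs" for t
    using permutes_in_image[OF permutes_funpow[OF cycle_permutes[of cs]], of t i] by simp
  have "(\<sigma> ^^ t) i = (cycle_of_list cs ^^ t) i"
  proof (induction t)
    case (Suc t)
    then show ?case using apply_in[OF in_cs] by (simp only: funpow.simps o_apply)
  qed simp
  \<comment> \<open>Applying a cycle to its own entries rotates the list, so the iterates of
    \<open>i\<close> are the heads of the rotations.\<close>
  also have "\<dots> = hd (map (cycle_of_list cs ^^ t) cs)" by simp
  also have "\<dots> = hd (rotate t cs)" using cyclic_rotation[OF cs(1)] by simp
  also have "\<dots> = cs ! (t mod length cs)" by (rule hd_rotate_conv_nth) simp
  finally show ?thesis .
qed

lemma least_power_eq: "least_power \<sigma> i = length cs"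
proof -
  have pos: "least_power \<sigma> i > 0" and eq: "(\<sigma> ^^ least_power \<sigma> i) i = i"
    using least_power_of_permutation[OF permutation(1)] by auto
  have "least_power \<sigma> i \<le> length cs"
    by (rule least_power_le) (use funpow_in[of "length cs"] in auto)
  moreover have "\<not> least_power \<sigma> i < length cs"
  proof
    assume less: "least_power \<sigma> i < length cs"
    then have "cs ! least_power \<sigma> i = cs ! 0" using eq funpow_in[of "least_power \<sigma> i"] by simp
    then show False using less pos nth_eq_iff_index_eq[OF cs(1) less, of 0] by simp
  qed
  ultimately show ?thesis by simp
qed

lemma support_eq: "support \<sigma> i = cs"
  unfolding least_power_eq by (rule nth_equalityI) (simp_all add: funpow_in del: upt_Suc)

lemma orb_in: "s \<in> set cs \<Longrightarrow> orb \<sigma> s = set cs"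
  using orb_eq_support[OF permutation(1), of i] orb_eq_or_disjoint[OF permutation(1), of s i]
    orb_self[of s \<sigma>] unfolding support_eq by blast

lemma funpow_notin: "s \<notin> set cs \<Longrightarrow> (\<sigma> ^^ t) s = (\<tau> ^^ t) s \<and> (\<tau> ^^ t) s \<notin> set cs"
proof (induction t)
  case (Suc t)
  then show ?case using apply_notin[of "(\<tau> ^^ t) s"] by simp
qed simp

lemma orb_notin: "s \<notin> set cs \<Longrightarrow> orb \<sigma> s = orb \<tau> s"
  unfolding orb_def using funpow_notin[THEN conjunct1] by simp

lemma cyc_prod_in: "cyc_prod M \<sigma> i = walk M i xs (\<lambda>r. M r i)"
  unfolding cyc_prod_eq_walk[OF permutation(1)] support_eq by simp

lemma cyc_prod_notin:
  assumes "s \<notin> set cs"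
  shows "cyc_prod M \<sigma> s = cyc_prod M \<tau> s"
  unfolding cyc_prod_def orb_notin[OF assms] funpow_notin[OF assms, THEN conjunct1] ..

lemma cyc_reps_eq: "cyc_reps I \<sigma> = insert (Min (set cs)) (cyc_reps J \<tau>)"
proof (rule set_eqI)
  fix s
  have m: "Min (set cs) \<in> set cs" by (rule Min_in) auto
  show "s \<in> cyc_reps I \<sigma> \<longleftrightarrow> s \<in> insert (Min (set cs)) (cyc_reps J \<tau>)"
  proof (cases "s \<in> set cs")
    case True
    then show ?thesis
      using cs(2) orb_in[OF True] by (auto simp: cyc_reps_def)
  next
    case False
    then show ?thesis
      using m orb_notin[OF False] by (auto simp: cyc_reps_def)
  qed
qed

lemma Min_notin: "Min (set cs) \<notin> cyc_reps J \<tau>"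
  using Min_in[of "set cs"] by (auto simp: cyc_reps_def)

text \<open>Removing the cycle takes away \<open>length xs + 1\<close> points and one orbit. A
  permutation never has more orbits than points, so the truncated subtractions lose nothing.\<close>

lemma sign_exponent:
  "card I - card (cyc_reps I \<sigma>) = length xs + (card J - card (cyc_reps J \<tau>))"
proof -
  have "card I = card J + Suc (length xs)"
    using cs card_Diff_subset[of "set cs" I] card_mono[OF fin cs(2)] distinct_card[OF cs(1)] by simp
  moreover have "card (cyc_reps I \<sigma>) = Suc (card (cyc_reps J \<tau>))"
    unfolding cyc_reps_eq using Min_notin fin by simp
  ultimately show ?thesis using card_cyc_reps_le[of J \<tau>] fin by simp
qed

text \<open>The cycle through \<open>i\<close> is the one that \<open>cdet_on\<close> sets apart, so
  the other representatives, and with them their decreasing order, are exactly those of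
  \<open>\<tau>\<close> on the complement.\<close>

lemma cdet_term:
  "(-1) ^ (card I - card (cyc_reps I \<sigma>)) *
     (qprod_list (map (cyc_prod M \<sigma>)
        (rev (sorted_list_of_set (cyc_reps I \<sigma> - {Min (orb \<sigma> i)})))) *
      cyc_prod M \<sigma> i) =
   (-1) ^ length xs * ((-1) ^ (card J - card (cyc_reps J \<tau>)) *
     prod_list (map (cyc_prod M \<tau>) (rev (sorted_list_of_set (cyc_reps J \<tau>)))) *
     walk M i xs (\<lambda>r. M r i))"
proof -
  have "orb \<sigma> i = set cs" by (rule orb_in) simp
  then have reps: "cyc_reps I \<sigma> - {Min (orb \<sigma> i)} = cyc_reps J \<tau>"
    using cyc_reps_eq Min_notin by simp
  have "map (cyc_prod M \<sigma>) (rev (sorted_list_of_set (cyc_reps J \<tau>))) =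
        map (cyc_prod M \<tau>) (rev (sorted_list_of_set (cyc_reps J \<tau>)))"
    using fin by (intro map_cong refl cyc_prod_notin) (auto simp: cyc_reps_def)
  then show ?thesis
    unfolding reps sign_exponent cyc_prod_in qprod_list_eq_prod_list
    by (simp only: power_add mult.assoc)
qed

end

text \<open>A permutation of \<open>I\<close> amounts to its cycle through \<open>i\<close>, listed
  from \<open>i\<close>, and a permutation of the complement. The inverse map reads the cycle off
  \<open>support\<close> and restricts the permutation to the remaining points.\<close>

theorem cdet_on_eq_path_det:
  assumes fin: "finite I" and iI: "i \<in> I"
  shows "cdet_on I i M = path_det M I i (\<lambda>r. M r i)"
proof -
  let ?J = "\<lambda>xs. I - insert i (set xs)"
  let ?S = "SIGMA xs:paths I i. {\<tau>. \<tau> permutes ?J xs}"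
  let ?rest = "\<lambda>\<sigma> y. if y \<in> I - set (support \<sigma> i) then \<sigma> y else y"
  have split: "cycle_split I i xs \<tau> (cycle_of_list (i # xs) \<circ> \<tau>)" if "(xs, \<tau>) \<in> ?S" for xs \<tau>
    using that fin iI by unfold_locales auto
  have "path_det M I i (\<lambda>r. M r i) = (\<Sum>(xs, \<tau>)\<in>?S. (-1) ^ length xs *
      ((-1) ^ (card (?J xs) - card (cyc_reps (?J xs) \<tau>)) *
       prod_list (map (cyc_prod M \<tau>) (rev (sorted_list_of_set (cyc_reps (?J xs) \<tau>)))) *
       walk M i xs (\<lambda>r. M r i)))"
    unfolding path_det_def cycle_det_def sum_distrib_right sum_distrib_left
    by (rule sum.Sigma) (auto simp: fin finite_paths finite_permutations)
  also have "\<dots> = cdet_on I i M"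
    unfolding cdet_on_def
  proof (rule sum.reindex_bij_witness[where
        j = "\<lambda>(xs, \<tau>). cycle_of_list (i # xs) \<circ> \<tau>" and i = "\<lambda>\<sigma>. (tl (support \<sigma> i), ?rest \<sigma>)"])
    fix p assume p: "p \<in> ?S"
    obtain xs \<tau> where pe: "p = (xs, \<tau>)" by (cases p)
    define \<sigma> where "\<sigma> = cycle_of_list (i # xs) \<circ> \<tau>"
    interpret cycle_split I i xs \<tau> \<sigma> using split p pe \<sigma>_def by simp
    have "?rest \<sigma> = \<tau>"
      unfolding support_eq using apply_notin(1) permutes_not_in[OF \<tau>] by auto
    then show "(tl (support (case p of (xs, \<tau>) \<Rightarrow> cycle_of_list (i # xs) \<circ> \<tau>) i),
               ?rest (case p of (xs, \<tau>) \<Rightarrow> cycle_of_list (i # xs) \<circ> \<tau>)) = p"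
      unfolding pe prod.case \<sigma>_def[symmetric] support_eq by simp
    show "(case p of (xs, \<tau>) \<Rightarrow> cycle_of_list (i # xs) \<circ> \<tau>) \<in> {\<tau>. \<tau> permutes I}"
      unfolding pe prod.case \<sigma>_def[symmetric] using permutes by simp
    show "(-1) ^ (card I - card (cyc_reps I (case p of (xs, \<tau>) \<Rightarrow> cycle_of_list (i # xs) \<circ> \<tau>))) *
      (qprod_list (map (cyc_prod M (case p of (xs, \<tau>) \<Rightarrow> cycle_of_list (i # xs) \<circ> \<tau>))
         (rev (sorted_list_of_set (cyc_reps I (case p of (xs, \<tau>) \<Rightarrow> cycle_of_list (i # xs) \<circ> \<tau>) -
           {Min (orb (case p of (xs, \<tau>) \<Rightarrow> cycle_of_list (i # xs) \<circ> \<tau>) i)})))) *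
       cyc_prod M (case p of (xs, \<tau>) \<Rightarrow> cycle_of_list (i # xs) \<circ> \<tau>) i) =
      (case p of (xs, \<tau>) \<Rightarrow> (-1) ^ length xs *
        ((-1) ^ (card (?J xs) - card (cyc_reps (?J xs) \<tau>)) *
         prod_list (map (cyc_prod M \<tau>) (rev (sorted_list_of_set (cyc_reps (?J xs) \<tau>)))) *
         walk M i xs (\<lambda>r. M r i)))"
      unfolding pe prod.case \<sigma>_def[symmetric] by (rule cdet_term)
  next
    fix \<sigma> assume "\<sigma> \<in> {\<tau>. \<tau> permutes I}"
    then have \<sigma>: "\<sigma> permutes I" by simp
    then have perm: "permutation \<sigma>" using fin permutation_permutes by blast
    have cons: "i # tl (support \<sigma> i) = support \<sigma> i"
      unfolding support_Cons[OF perm] by simp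
    have set_eq: "insert i (set (tl (support \<sigma> i))) = set (support \<sigma> i)"
      using arg_cong[OF cons, of set] by simp
    have orb: "set (support \<sigma> i) \<subseteq> I"
      using orb_subset[OF \<sigma> iI] orb_eq_support[OF perm] by simp
    have "cycle_of_list (support \<sigma> i) \<circ> ?rest \<sigma> = \<sigma>"
    proof
      fix a
      show "(cycle_of_list (support \<sigma> i) \<circ> ?rest \<sigma>) a = \<sigma> a"
      proof (cases "a \<in> set (support \<sigma> i)")
        case True
        then show ?thesis using cycle_restrict[OF perm True] by simp
      next
        case False
        \<comment> \<open>Otherwise the orbits of \<open>a\<close> and \<open>i\<close> would meet
          and hence coincide.\<close>
        have "\<sigma> a \<notin> set (support \<sigma> i)"
        proof
          assume *: "\<sigma> a \<in> set (support \<sigma> i)"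
          have "\<sigma> a \<in> orb \<sigma> a" unfolding orb_def by (rule CollectI, rule exI[of _ 1]) simp
          then have "orb \<sigma> a = orb \<sigma> i"
            using * orb_eq_or_disjoint[OF perm, of a i] orb_eq_support[OF perm, of i] by blast
          then show False using False orb_self[of a \<sigma>] orb_eq_support[OF perm, of i] by simp
        qed
        then show ?thesis
          using False permutes_not_in[OF \<sigma>, of a]
          by (cases "a \<in> I") (simp_all only: o_apply id_outside_supp Diff_iff simp_thms if_True if_False)
      qed
    qed
    then show "(case (tl (support \<sigma> i), ?rest \<sigma>) of (xs, \<tau>) \<Rightarrow> cycle_of_list (i # xs) \<circ> \<tau>) = \<sigma>"
      unfolding prod.case cons .
    have "tl (support \<sigma> i) \<in> paths I i"
      unfolding paths_def mem_Collect_eq cons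
      using cycle_of_permutation[OF perm, of i] orb set_eq by blast
    moreover have "?rest \<sigma> permutes I - set (support \<sigma> i)"
      using semidecomposition[OF \<sigma> fin] .
    ultimately show "(tl (support \<sigma> i), ?rest \<sigma>) \<in> ?S"
      unfolding mem_Sigma_iff mem_Collect_eq set_eq by blast
  qed
  finally show ?thesis ..
qed

section \<open>Replaced columns and the determinant at the least index\<close>

lemma cycle_det_cong:
  assumes fin: "finite J" and eq: "\<And>r c. r \<in> J \<Longrightarrow> c \<in> J \<Longrightarrow> M r c = M' r c"
  shows "cycle_det M J = cycle_det M' J"
proof -
  have "cyc_prod M \<tau> s = cyc_prod M' \<tau> s" if \<tau>: "\<tau> permutes J" and s: "s \<in> J" for \<tau> s
  proof -
    have "(\<tau> ^^ t) s \<in> J" for t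
      using permutes_in_image[OF permutes_funpow[OF \<tau>]] s by simp
    then have "M ((\<tau> ^^ t) s) ((\<tau> ^^ Suc t) s) = M' ((\<tau> ^^ t) s) ((\<tau> ^^ Suc t) s)" for t
      using eq by blast
    then show ?thesis unfolding cyc_prod_def by simp
  qed
  then have "map (cyc_prod M \<tau>) (rev (sorted_list_of_set (cyc_reps J \<tau>))) =
      map (cyc_prod M' \<tau>) (rev (sorted_list_of_set (cyc_reps J \<tau>)))" if "\<tau> permutes J" for \<tau>
    using that fin by (intro map_cong) (auto simp: cyc_reps_def)
  then show ?thesis
    unfolding cycle_det_def by (intro sum.cong refl arg_cong2[where f = "(*)"]) (simp only: mem_Collect_eq)
qed

lemma walk_cong:
  assumes "\<And>r c. c \<in> set xs \<Longrightarrow> M r c = M' r c" "\<And>r. b r = b' r"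
  shows "walk M i xs b = walk M' i xs b'"
  using assms by (induction xs arbitrary: i) auto

text \<open>Column \<open>i\<close> is read only when the cycle closes up: intermediate vertices
  differ from \<open>i\<close>, and the complementary determinants avoid it.\<close>

lemma cdet_on_repl_col:
  assumes "finite I" "i \<in> I"
  shows "cdet_on I i (repl_col M i b) = path_det M I i b"
  unfolding cdet_on_eq_path_det[OF assms] path_det_def
  by (intro sum.cong refl arg_cong2[where f = "(*)"] cycle_det_cong walk_cong)
     (auto simp: assms repl_col_def paths_def)

lemma cycle_det_empty [simp]: "cycle_det M {} = 1"
  by (simp add: cycle_det_def cyc_reps_def)

text \<open>The cycle through \<open>Min J\<close> has the smallest representative, so the
  decreasing order already puts it last.\<close>

lemma cdet_on_Min:
  assumes fin: "finite J" and ne: "J \<noteq> {}"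
  shows "cdet_on J (Min J) M = cycle_det M J"
  unfolding cdet_on_def cycle_det_def qprod_list_eq_prod_list
proof (intro sum.cong refl arg_cong2[where f = "(*)"])
  fix \<tau> assume "\<tau> \<in> {\<tau>. \<tau> permutes J}"
  then have \<tau>: "\<tau> permutes J" by simp
  have Min: "Min J \<in> J" using fin ne by simp
  have orb: "Min (orb \<tau> (Min J)) = Min J"
    using orb_subset[OF \<tau> Min] orb_self[of "Min J" \<tau>] fin
    by (intro Min_eqI) (auto intro: finite_subset)
  have "Min (cyc_reps J \<tau>) = Min J"
    using orb Min fin by (intro Min_eqI) (auto simp: cyc_reps_def)
  moreover have "cyc_reps J \<tau> \<noteq> {}" using orb Min by (auto simp: cyc_reps_def)
  ultimately have "sorted_list_of_set (cyc_reps J \<tau>) =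
      Min J # sorted_list_of_set (cyc_reps J \<tau> - {Min (orb \<tau> (Min J))})"
    using sorted_list_of_set_nonempty[of "cyc_reps J \<tau>"] fin orb by simp
  then show "prod_list (map (cyc_prod M \<tau>)
         (rev (sorted_list_of_set (cyc_reps J \<tau> - {Min (orb \<tau> (Min J))})))) *
       cyc_prod M \<tau> (Min J) =
      prod_list (map (cyc_prod M \<tau>) (rev (sorted_list_of_set (cyc_reps J \<tau>))))"
    by simp
qed

section \<open>Row and column determinants of Hermitian matrices\<close>

text \<open>A pair stands either for the single path \<open>ps @ j # qs\<close> from
  \<open>i\<close> through \<open>j\<close>, or for two disjoint paths starting in \<open>i\<close>
  and \<open>j\<close>.\<close>

definition path_pairs :: "nat set \<Rightarrow> nat \<Rightarrow> nat \<Rightarrow> (nat list \<times> nat list) set" where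
  "path_pairs I i j = {(ps, qs). distinct (i # ps @ j # qs) \<and> set ps \<union> set qs \<subseteq> I}"

lemma path_pairs_eq_Sigma:
  "path_pairs I i j = (SIGMA ps:paths (I - {j}) i. paths (I - insert i (set ps)) j)"
  if "i \<noteq> j"
  using that by (auto simp: path_pairs_def paths_def)

lemma finite_path_pairs: "finite I \<Longrightarrow> i \<noteq> j \<Longrightarrow> finite (path_pairs I i j)"
  unfolding path_pairs_eq_Sigma by (intro finite_SigmaI finite_paths) auto

lemma paths_split:
  assumes "i \<noteq> j" "j \<in> I"
  shows "paths I i = paths (I - {j}) i \<union> (\<lambda>(ps, qs). ps @ j # qs) ` path_pairs I i j"
proof (intro equalityI subsetI)
  fix xs assume xs: "xs \<in> paths I i"
  show "xs \<in> paths (I - {j}) i \<union> (\<lambda>(ps, qs). ps @ j # qs) ` path_pairs I i j"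
  proof (cases "j \<in> set xs")
    case True
    then obtain ps qs where "xs = ps @ j # qs" by (meson split_list)
    with xs have "(ps, qs) \<in> path_pairs I i j" "xs = ps @ j # qs"
      by (auto simp: paths_def path_pairs_def)
    then show ?thesis by force
  next
    case False
    with xs show ?thesis by (auto simp: paths_def)
  qed
qed (use assms in \<open>auto simp: paths_def path_pairs_def\<close>)

lemma sum_paths_split:
  assumes fin: "finite I" and ij: "i \<noteq> j" "j \<in> I"
  shows "(\<Sum>xs\<in>paths I i. f xs) =
    (\<Sum>ps\<in>paths (I - {j}) i. f ps) + (\<Sum>(ps, qs)\<in>path_pairs I i j. f (ps @ j # qs))"
proof -
  \<comment> \<open>Distinctness lets \<open>j\<close> occur only once, so the place of the split is
    determined.\<close>
  have inj: "inj_on (\<lambda>(ps, qs). ps @ j # qs) (path_pairs I i j)"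
    by (auto simp: inj_on_def path_pairs_def append_Cons_eq_iff)
  have "(\<Sum>xs\<in>paths I i. f xs) =
    (\<Sum>ps\<in>paths (I - {j}) i. f ps) + (\<Sum>xs\<in>(\<lambda>(ps, qs). ps @ j # qs) ` path_pairs I i j. f xs)"
    unfolding paths_split[OF ij]
    using fin ij
    by (intro sum.union_disjoint finite_imageI finite_paths finite_path_pairs finite_Diff)
       (auto simp: paths_def)
  then show ?thesis
    unfolding sum.reindex[OF inj] by (simp add: case_prod_unfold comp_def)
qed

lemma sum_path_pairs:
  assumes "finite I" "i \<noteq> j"
  shows "(\<Sum>(ps, qs)\<in>path_pairs I i j. f ps qs) =
    (\<Sum>ps\<in>paths (I - {j}) i. \<Sum>qs\<in>paths (I - insert i (set ps)) j. f ps qs)"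
  unfolding path_pairs_eq_Sigma[OF assms(2)]
  by (rule sum.Sigma[symmetric]) (auto simp: assms finite_paths)

lemma neg_one_power_left_commute: "x * ((-1) ^ k * y) = (-1) ^ k * (x * (y :: 'a :: ring_1))"
  by (cases "even k") simp_all

text \<open>The condition is imposed at all indices; a Gram matrix satisfies it because one formula
  defines all its entries.\<close>

locale hermitian =
  fixes M :: qmat
  assumes hermitian: "qcnj (M r c) = M c r"
begin

text \<open>Conjugation reverses the product and, for a Hermitian matrix, each edge in it.\<close>

lemma qcnj_walk: "qcnj (walk M i xs (\<lambda>r. M r j)) = walk M j (rev xs) (\<lambda>r. M r i)"
  by (induction xs arbitrary: i) (simp_all add: hermitian qcnj_mult walk_snoc)

text \<open>Reversing a cycle through \<open>i\<close> keeps its vertex set and thus the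
  complementary factor, which is real and so is moved freely past the reversed walk.\<close>

lemma qcnj_path_det:
  assumes "\<forall>J. J \<subset> I \<longrightarrow> cycle_det M J = of_real (qr (cycle_det M J))" "i \<in> I"
  shows "qcnj (path_det M I i (\<lambda>r. M r i)) = path_det M I i (\<lambda>r. M r i)"
  unfolding path_det_def qcnj_sum
proof (rule sum.reindex_bij_witness[where i = rev and j = rev])
  fix xs assume "xs \<in> paths I i"
  define d where "d = qr (cycle_det M (I - insert i (set xs)))"
  have "I - insert i (set xs) \<subset> I" using assms(2) by auto
  then have d: "cycle_det M (I - insert i (set xs)) = of_real d"
    unfolding d_def by (rule assms(1)[rule_format])
  show "(-1) ^ length (rev xs) * (cycle_det M (I - insert i (set (rev xs))) *
       walk M i (rev xs) (\<lambda>r. M r i)) =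
      qcnj ((-1) ^ length xs * (cycle_det M (I - insert i (set xs)) * walk M i xs (\<lambda>r. M r i)))"
    using neg_one_power_left_commute[of "walk M i (rev xs) (\<lambda>r. M r i) * of_real d" "length xs" 1]
    by (simp add: d qcnj_mult qcnj_walk of_real_quat_commute[of d "walk M i (rev xs) (\<lambda>r. M r i)"])
qed (auto simp: paths_def)

lemma qr_path_det:
  assumes "\<forall>J. J \<subset> I \<longrightarrow> cycle_det M J = of_real (qr (cycle_det M J))" "i \<in> I"
  shows "qr (path_det M I i (\<lambda>r. M r i)) = (\<Sum>xs\<in>paths I i. (-1) ^ length xs *
    (qr (cycle_det M (I - insert i (set xs))) * qr (walk M i xs (\<lambda>r. M r i))))"
  unfolding path_det_def qr_sum
proof (intro sum.cong refl)
  fix xs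
  define d where "d = qr (cycle_det M (I - insert i (set xs)))"
  have "I - insert i (set xs) \<subset> I" using assms(2) by auto
  then have d: "cycle_det M (I - insert i (set xs)) = of_real d"
    unfolding d_def by (rule assms(1)[rule_format])
  have "(-1) ^ length xs = (of_real ((-1) ^ length xs) :: quat)" by simp
  then show "qr ((-1) ^ length xs * (cycle_det M (I - insert i (set xs)) * walk M i xs (\<lambda>r. M r i))) =
    (-1) ^ length xs * (qr (cycle_det M (I - insert i (set xs))) * qr (walk M i xs (\<lambda>r. M r i)))"
    unfolding d by (simp only: qr_of_real_mult quat_sel)
qed

text \<open>Both cycles through \<open>i\<close> avoiding \<open>j\<close> (paired with a cycle through \<open>j\<close> in the complement)
  and cycles through \<open>i\<close> and \<open>j\<close> are encoded by pairs of paths, which makes the expansion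
  symmetric in \<open>i\<close> and \<open>j\<close>.\<close>
lemma qr_path_det_pairs:
  assumes fin: "finite I"
    and real: "\<forall>J. J \<subset> I \<longrightarrow> cycle_det M J = of_real (qr (cycle_det M J))"
    and path: "\<forall>J j. J \<subset> I \<longrightarrow> j \<in> J \<longrightarrow> path_det M J j (\<lambda>r. M r j) = cycle_det M J"
    and ij: "i \<in> I" "j \<in> I" "i \<noteq> j"
  shows "qr (path_det M I i (\<lambda>r. M r i)) = (\<Sum>(ps, qs)\<in>path_pairs I i j.
    (-1) ^ (length ps + length qs) *
    (qr (cycle_det M (I - insert i (set ps) - insert j (set qs))) *
     (qr (walk M i ps (\<lambda>r. M r i)) * qr (walk M j qs (\<lambda>r. M r j)) -
      qr (walk M i ps (\<lambda>r. M r j) * walk M j qs (\<lambda>r. M r i)))))"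
proof -
  let ?d = "\<lambda>J. qr (cycle_det M J)"
  let ?w = "\<lambda>i xs. qr (walk M i xs (\<lambda>r. M r i))"
  have d: "?d (I - insert i (set ps)) = (\<Sum>qs\<in>paths (I - insert i (set ps)) j. (-1) ^ length qs *
      (?d (I - insert i (set ps) - insert j (set qs)) * ?w j qs))"
    if "ps \<in> paths (I - {j}) i" for ps
  proof -
    let ?J = "I - insert i (set ps)"
    have J: "?J \<subset> I" and j: "j \<in> ?J" using ij that by (auto simp: paths_def)
    then have "?d ?J = qr (path_det M ?J j (\<lambda>r. M r j))" using path by simp
    moreover have "\<forall>K. K \<subset> ?J \<longrightarrow> cycle_det M K = of_real (?d K)"
      using real J by (meson psubset_trans)
    ultimately show ?thesis using qr_path_det[OF _ j] by (simp only:)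
  qed
  have "(\<Sum>ps\<in>paths (I - {j}) i. (-1) ^ length ps * (?d (I - insert i (set ps)) * ?w i ps)) =
    (\<Sum>(ps, qs)\<in>path_pairs I i j. (-1) ^ (length ps + length qs) *
      (?d (I - insert i (set ps) - insert j (set qs)) * (?w i ps * ?w j qs)))"
    unfolding sum_path_pairs[OF fin ij(3)]
    by (intro sum.cong refl, subst d)
       (simp_all add: sum_distrib_left sum_distrib_right power_add mult_ac)
  \<comment> \<open>The extra vertex \<open>j\<close> makes the path one longer, whence the minus
    sign.\<close>
  moreover have "(\<Sum>(ps, qs)\<in>path_pairs I i j. (-1) ^ length (ps @ j # qs) *
      (?d (I - insert i (set (ps @ j # qs))) * ?w i (ps @ j # qs))) =
    (\<Sum>(ps, qs)\<in>path_pairs I i j. - ((-1) ^ (length ps + length qs) *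
      (?d (I - insert i (set ps) - insert j (set qs)) *
       qr (walk M i ps (\<lambda>r. M r j) * walk M j qs (\<lambda>r. M r i)))))"
  proof (intro sum.cong refl)
    fix p assume "p \<in> path_pairs I i j"
    obtain ps qs where p: "p = (ps, qs)" by (cases p)
    have "I - insert i (set (ps @ j # qs)) = I - insert i (set ps) - insert j (set qs)" by auto
    then show "(case p of (ps, qs) \<Rightarrow> (-1) ^ length (ps @ j # qs) *
        (?d (I - insert i (set (ps @ j # qs))) * ?w i (ps @ j # qs))) =
      (case p of (ps, qs) \<Rightarrow> - ((-1) ^ (length ps + length qs) *
        (?d (I - insert i (set ps) - insert j (set qs)) *
         qr (walk M i ps (\<lambda>r. M r j) * walk M j qs (\<lambda>r. M r i)))))"
      unfolding p by (simp add: walk_append)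
  qed
  ultimately show ?thesis
    unfolding qr_path_det[OF real ij(1)] sum_paths_split[OF fin ij(3,2)]
    by (simp only: sum.distrib[symmetric] case_prod_unfold distrib_left diff_conv_add_uminus
        mult_minus_right)
qed

text \<open>Realness on proper subsets makes each expansion self-conjugate, hence real. Comparing
  real parts through pairs of paths then shows that the start is immaterial, and at
  \<open>Min I\<close> the expansion is \<open>cycle_det\<close>. Each claim needs the other on
  smaller sets, so they share one induction.\<close>

lemma path_det_eq_cycle_det_aux:
  assumes "finite I"
  shows "cycle_det M I = of_real (qr (cycle_det M I)) \<and>
    (\<forall>i\<in>I. path_det M I i (\<lambda>r. M r i) = cycle_det M I)"
  using assms
proof (induction I rule: finite_psubset_induct)
  case (psubset I)
  have real: "\<forall>J. J \<subset> I \<longrightarrow> cycle_det M J = of_real (qr (cycle_det M J))"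
    and path: "\<forall>J j. J \<subset> I \<longrightarrow> j \<in> J \<longrightarrow> path_det M J j (\<lambda>r. M r j) = cycle_det M J"
    using psubset.IH by blast+
  let ?g = "\<lambda>i. path_det M I i (\<lambda>r. M r i)"
  have g_real: "?g i = of_real (qr (?g i))" if "i \<in> I" for i
    using qcnj_path_det[OF real that] by (rule qcnj_fixed_imp_real)
  have g_eq: "?g i = ?g j" if ij: "i \<in> I" "j \<in> I" for i j
  proof (cases "i = j")
    case False
    have "qr (?g i) = qr (?g j)"
      unfolding qr_path_det_pairs[OF psubset.hyps real path ij False]
        qr_path_det_pairs[OF psubset.hyps real path ij(2,1) False[symmetric]]
    proof (rule sum.reindex_bij_witness[where i = prod.swap and j = prod.swap])
      fix p assume "p \<in> path_pairs I i j"
      obtain ps qs where p: "p = (ps, qs)" by (cases p)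
      have sets: "I - insert j (set qs) - insert i (set ps) = I - insert i (set ps) - insert j (set qs)"
        by auto
      \<comment> \<open>Swapping the pair only rotates the product of the two connecting walks,
        which the real part does not detect.\<close>
      show "(case prod.swap p of (ps, qs) \<Rightarrow> (-1) ^ (length ps + length qs) *
          (qr (cycle_det M (I - insert j (set ps) - insert i (set qs))) *
           (qr (walk M j ps (\<lambda>r. M r j)) * qr (walk M i qs (\<lambda>r. M r i)) -
            qr (walk M j ps (\<lambda>r. M r i) * walk M i qs (\<lambda>r. M r j))))) =
        (case p of (ps, qs) \<Rightarrow> (-1) ^ (length ps + length qs) *
          (qr (cycle_det M (I - insert i (set ps) - insert j (set qs))) *
           (qr (walk M i ps (\<lambda>r. M r i)) * qr (walk M j qs (\<lambda>r. M r j)) -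
            qr (walk M i ps (\<lambda>r. M r j) * walk M j qs (\<lambda>r. M r i)))))"
        using qr_mult_commute[of "walk M j qs (\<lambda>r. M r i)" "walk M i ps (\<lambda>r. M r j)"] sets
        unfolding p by (simp add: add.commute mult.commute)
    qed (auto simp: path_pairs_def)
    then show ?thesis using g_real ij by metis
  qed simp
  show ?case
  proof (cases "I = {}")
    case False
    then have Min: "Min I \<in> I" using psubset.hyps by simp
    then have "cycle_det M I = ?g (Min I)"
      using cdet_on_Min[OF psubset.hyps False] cdet_on_eq_path_det[OF psubset.hyps Min] by simp
    then show ?thesis using g_real g_eq Min by metis
  qed simp
qed

lemma cycle_det_real: "finite I \<Longrightarrow> cycle_det M I = of_real (qr (cycle_det M I))"
  and path_det_diag: "finite I \<Longrightarrow> i \<in> I \<Longrightarrow> path_det M I i (\<lambda>r. M r i) = cycle_det M I"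
  using path_det_eq_cycle_det_aux by blast+

lemma cycle_det_commute: "finite I \<Longrightarrow> cycle_det M I * x = x * cycle_det M I"
  by (metis cycle_det_real of_real_quat_commute)

text \<open>A path from \<open>i\<close> to \<open>j\<close> followed by a cycle at \<open>j\<close> in the complement contributes the same
  walk as a path from \<open>i\<close> through \<open>j\<close>, with the opposite sign.\<close>
lemma path_det_off_diag:
  assumes fin: "finite I" and ij: "i \<in> I" "j \<in> I" "i \<noteq> j"
  shows "path_det M I i (\<lambda>r. M r j) = 0"
proof -
  let ?W = "\<lambda>i xs. walk M i xs (\<lambda>r. M r j)"
  let ?D = "\<lambda>ps qs. cycle_det M (I - insert i (set ps) - insert j (set qs))"
  have "(\<Sum>ps\<in>paths (I - {j}) i. (-1) ^ length ps *
        (cycle_det M (I - insert i (set ps)) * ?W i ps)) =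
    (\<Sum>(ps, qs)\<in>path_pairs I i j. (-1) ^ (length ps + length qs) * (?D ps qs * (?W i ps * ?W j qs)))"
    unfolding sum_path_pairs[OF fin ij(3)]
  proof (intro sum.cong refl)
    fix ps assume "ps \<in> paths (I - {j}) i"
    then have j: "j \<in> I - insert i (set ps)" using ij by (auto simp: paths_def)
    have commute: "?W i ps * (?D ps qs * y) = ?D ps qs * (?W i ps * y)" for qs y
      using cycle_det_commute[of "I - insert i (set ps) - insert j (set qs)" "?W i ps"] fin
      by (simp add: mult.assoc[symmetric])
    \<comment> \<open>Being central, the complementary determinant can be moved behind the walk
      before it is expanded along the cycle at \<open>j\<close>.\<close>
    have "cycle_det M (I - insert i (set ps)) * ?W i ps =
        ?W i ps * path_det M (I - insert i (set ps)) j (\<lambda>r. M r j)"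
      using cycle_det_commute path_det_diag[OF _ j] fin by simp
    also have "\<dots> = (\<Sum>qs\<in>paths (I - insert i (set ps)) j.
        (-1) ^ length qs * (?D ps qs * (?W i ps * ?W j qs)))"
      unfolding path_det_def sum_distrib_left
      by (intro sum.cong refl)
         (simp only: neg_one_power_left_commute commute)
    finally show "(-1) ^ length ps * (cycle_det M (I - insert i (set ps)) * ?W i ps) =
      (\<Sum>qs\<in>paths (I - insert i (set ps)) j.
        (-1) ^ (length ps + length qs) * (?D ps qs * (?W i ps * ?W j qs)))"
      by (simp add: sum_distrib_left power_add mult.assoc)
  qed
  moreover have "(\<Sum>(ps, qs)\<in>path_pairs I i j. (-1) ^ length (ps @ j # qs) *
      (cycle_det M (I - insert i (set (ps @ j # qs))) * ?W i (ps @ j # qs))) =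
    - (\<Sum>(ps, qs)\<in>path_pairs I i j. (-1) ^ (length ps + length qs) * (?D ps qs * (?W i ps * ?W j qs)))"
    unfolding sum_negf[symmetric]
  proof (intro sum.cong refl)
    fix p assume "p \<in> path_pairs I i j"
    obtain ps qs where p: "p = (ps, qs)" by (cases p)
    have "I - insert i (set (ps @ j # qs)) = I - insert i (set ps) - insert j (set qs)" by auto
    then show "(case p of (ps, qs) \<Rightarrow> (-1) ^ length (ps @ j # qs) *
        (cycle_det M (I - insert i (set (ps @ j # qs))) * ?W i (ps @ j # qs))) =
      - (case p of (ps, qs) \<Rightarrow> (-1) ^ (length ps + length qs) * (?D ps qs * (?W i ps * ?W j qs)))"
      unfolding p by (simp add: walk_append)
  qed
  ultimately show ?thesis
    unfolding path_det_def sum_paths_split[OF fin ij(3,2)] by simp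
qed

end

section \<open>Cofactors and sums of principal minors\<close>

abbreviation unit_vec :: "nat \<Rightarrow> nat \<Rightarrow> quat" where
  "unit_vec k \<equiv> \<lambda>r. if r = k then 1 else 0"

text \<open>Entry \<open>(i, k)\<close> of the adjugate of the principal submatrix on
  \<open>I\<close>: the left coefficient of \<open>b k\<close> in \<open>path_det\<close>.\<close>

definition cofactor :: "qmat \<Rightarrow> nat set \<Rightarrow> nat \<Rightarrow> nat \<Rightarrow> quat" where
  "cofactor M I i k = path_det M I i (unit_vec k)"

text \<open>A walk uses \<open>b\<close> only at its last vertex, which lies in
  \<open>I\<close>.\<close>

lemma walk_expand:
  assumes "finite I" "set (i # xs) \<subseteq> I"
  shows "walk M i xs b = (\<Sum>k\<in>I. walk M i xs (unit_vec k) * b k)"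
  using assms(2)
proof (induction xs arbitrary: i)
  case Nil
  then show ?case using assms(1) by (simp add: if_distrib[of "\<lambda>x. x * _"] cong: if_cong)
qed (simp add: sum_distrib_left mult.assoc)

lemma walk_unit_vec_notin: "k \<notin> set (i # xs) \<Longrightarrow> walk M i xs (unit_vec k) = 0"
  by (induction xs arbitrary: i) simp_all

lemma walk_unit_vec_start: "i \<notin> set xs \<Longrightarrow> walk M i xs (unit_vec i) = (if xs = [] then 1 else 0)"
  by (cases xs) (simp_all add: walk_unit_vec_notin)

lemma path_det_expand:
  assumes "finite I" "i \<in> I"
  shows "path_det M I i b = (\<Sum>k\<in>I. cofactor M I i k * b k)"
proof -
  have "path_det M I i b = (\<Sum>xs\<in>paths I i. \<Sum>k\<in>I. (-1) ^ length xs *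
     (cycle_det M (I - insert i (set xs)) * walk M i xs (unit_vec k)) * b k)"
    unfolding path_det_def
    by (intro sum.cong refl, subst walk_expand[OF assms(1)])
       (use assms in \<open>auto simp: paths_def sum_distrib_left mult.assoc\<close>)
  then show ?thesis
    unfolding cofactor_def path_det_def sum_distrib_right by (subst sum.swap) simp
qed

lemma cofactor_notin:
  assumes "i \<in> I" "k \<notin> I"
  shows "cofactor M I i k = 0"
proof -
  have "walk M i xs (unit_vec k) = 0" if "xs \<in> paths I i" for xs
    using that assms by (intro walk_unit_vec_notin) (auto simp: paths_def)
  then show ?thesis unfolding cofactor_def path_det_def by simp
qed

text \<open>A path never returns to its start, so only the empty one ends in
  \<open>i\<close>.\<close>

lemma sum_paths_unit_vec:
  assumes "finite I"
  shows "(\<Sum>xs\<in>paths I i. f xs * walk M i xs (unit_vec i)) = f []"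
proof -
  have "(\<Sum>xs\<in>paths I i. f xs * walk M i xs (unit_vec i)) =
      (\<Sum>xs\<in>paths I i. if xs = [] then f xs else 0)"
    by (intro sum.cong refl) (auto simp: paths_def walk_unit_vec_start)
  also have "\<dots> = f []"
    using finite_paths[OF assms, of i] by (simp add: sum.delta paths_def)
  finally show ?thesis .
qed

lemma cofactor_diag: "finite I \<Longrightarrow> cofactor M I i i = cycle_det M (I - {i})"
  unfolding cofactor_def path_det_def mult.assoc[symmetric] by (subst sum_paths_unit_vec) simp_all

text \<open>A path contributes only if it ends in \<open>j\<close>. Dropping that vertex leaves a
  path in \<open>I\<close> with the same complement, whose step into \<open>j\<close> reads column
  \<open>j\<close> of \<open>M\<close>; the lost vertex accounts for the sign.\<close>

lemma cofactor_insert: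
  assumes fin: "finite I" and ij: "i \<in> I" "j \<notin> I"
  shows "cofactor M (insert j I) i j = - path_det M I i (\<lambda>r. M r j)"
proof -
  have ne: "i \<noteq> j" and I: "insert j I - {j} = I" using ij by auto
  let ?D = "\<lambda>ps qs. cycle_det M (insert j I - insert i (set (ps @ j # qs)))"
  have 0: "walk M i ps (unit_vec j) = 0" if "ps \<in> paths I i" for ps
    using that ij by (intro walk_unit_vec_notin) (auto simp: paths_def)
  have "(\<Sum>qs\<in>paths (insert j I - insert i (set ps)) j. (-1) ^ length (ps @ j # qs) *
      (?D ps qs * walk M i (ps @ j # qs) (unit_vec j))) =
    - ((-1) ^ length ps * (cycle_det M (I - insert i (set ps)) * walk M i ps (\<lambda>r. M r j)))"
    if "ps \<in> paths I i" for ps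
  proof -
    have "insert j I - insert i (set (ps @ [j])) = I - insert i (set ps)"
      using that ij by (auto simp: paths_def)
    then show ?thesis
      unfolding walk_append mult.assoc[symmetric]
      by (subst sum_paths_unit_vec) (use fin in \<open>simp_all add: mult.assoc\<close>)
  qed
  then show ?thesis
    unfolding cofactor_def path_det_def
    by (subst sum_paths_split[where j = j])
       (simp_all add: fin ne I 0 sum_path_pairs sum_negf)
qed

section \<open>Principal minors and adjugates summed over index sets\<close>

definition index_sets :: "nat \<Rightarrow> nat \<Rightarrow> nat set set" where
  "index_sets n k = {\<beta>. \<beta> \<subseteq> {..<n} \<and> card \<beta> = k}"

lemma finite_index_sets [simp]: "finite (index_sets n k)"
  by (rule finite_subset[of _ "Pow {..<n}"]) (auto simp: index_sets_def)

lemma index_setsD: "\<beta> \<in> index_sets n k \<Longrightarrow> finite \<beta> \<and> \<beta> \<subseteq> {..<n} \<and> card \<beta> = k"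
  by (auto simp: index_sets_def intro: finite_subset)

definition minor_sum :: "qmat \<Rightarrow> nat \<Rightarrow> nat \<Rightarrow> quat" where
  "minor_sum M n k = (\<Sum>\<beta>\<in>index_sets n k. cycle_det M \<beta>)"

text \<open>The restriction to \<open>i \<in> \<beta>\<close> pads the rows with zeros, since
  \<open>cofactor\<close> need not vanish for \<open>i\<close> outside \<open>\<beta>\<close>; for
  the columns \<open>cofactor_notin\<close> does this.\<close>

definition cofactor_sum :: "qmat \<Rightarrow> nat \<Rightarrow> nat \<Rightarrow> qmat" where
  "cofactor_sum M n k = (\<lambda>i j. \<Sum>\<beta> | \<beta> \<in> index_sets n k \<and> i \<in> \<beta>. cofactor M \<beta> i j)"

text \<open>For \<open>B = qct A\<close> the right-hand side is the numerator of the column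
  formula.\<close>

lemma qmmul_cofactor_sum:
  "qmmul n (cofactor_sum M n k) B i j =
    (\<Sum>\<beta> | \<beta> \<in> index_sets n k \<and> i \<in> \<beta>. path_det M \<beta> i (\<lambda>r. B r j))"
proof -
  have "qmmul n (cofactor_sum M n k) B i j =
      (\<Sum>\<beta> | \<beta> \<in> index_sets n k \<and> i \<in> \<beta>. \<Sum>l<n. cofactor M \<beta> i l * B l j)"
    unfolding qmmul_def cofactor_sum_def sum_distrib_right by (rule sum.swap)
  also have "\<dots> = (\<Sum>\<beta> | \<beta> \<in> index_sets n k \<and> i \<in> \<beta>. path_det M \<beta> i (\<lambda>r. B r j))"
  proof (intro sum.cong refl)
    fix \<beta> assume \<beta>: "\<beta> \<in> {\<beta>. \<beta> \<in> index_sets n k \<and> i \<in> \<beta>}"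
    then have "path_det M \<beta> i (\<lambda>r. B r j) = (\<Sum>l\<in>\<beta>. cofactor M \<beta> i l * B l j)"
      using index_setsD by (intro path_det_expand) auto
    also have "\<dots> = (\<Sum>l<n. cofactor M \<beta> i l * B l j)"
      using \<beta> index_setsD by (intro sum.mono_neutral_left) (auto simp: cofactor_notin)
    finally show "(\<Sum>l<n. cofactor M \<beta> i l * B l j) = path_det M \<beta> i (\<lambda>r. B r j)" ..
  qed
  finally show ?thesis .
qed

text \<open>Comparing the coefficients of powers of \<open>t\<close> in \<open>adj (t + M) (t + M) = det (t + M)\<close>
  gives this identity.\<close>
lemma (in hermitian) cofactor_sum_recurrence:
  assumes i: "i < n" and j: "j < n"
  shows "qmmul n (cofactor_sum M n k) M i j + cofactor_sum M n (Suc k) i j =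
    (if i = j then minor_sum M n k else 0)"
proof (cases "i = j")
  case True
  have "qmmul n (cofactor_sum M n k) M i i =
      (\<Sum>\<beta> | \<beta> \<in> index_sets n k \<and> i \<in> \<beta>. cycle_det M \<beta>)"
    unfolding qmmul_cofactor_sum using index_setsD by (intro sum.cong refl path_det_diag) auto
  \<comment> \<open>Deleting \<open>i\<close> maps the sets of size \<open>Suc k\<close> containing
    \<open>i\<close> onto the sets of size \<open>k\<close> avoiding it and turns diagonal cofactors
    into principal minors.\<close>
  moreover have "cofactor_sum M n (Suc k) i i =
      (\<Sum>\<beta> | \<beta> \<in> index_sets n k \<and> i \<notin> \<beta>. cycle_det M \<beta>)"
    unfolding cofactor_sum_def
  proof (rule sum.reindex_bij_witness[where i = "insert i" and j = "\<lambda>\<beta>. \<beta> - {i}"])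
    fix \<beta> assume "\<beta> \<in> {\<beta>. \<beta> \<in> index_sets n (Suc k) \<and> i \<in> \<beta>}"
    then have \<beta>: "finite \<beta>" "\<beta> \<subseteq> {..<n}" "card \<beta> = Suc k" "i \<in> \<beta>" using index_setsD by auto
    show "insert i (\<beta> - {i}) = \<beta>" using \<beta> by auto
    show "\<beta> - {i} \<in> {\<beta>. \<beta> \<in> index_sets n k \<and> i \<notin> \<beta>}" using \<beta> by (auto simp: index_sets_def)
    show "cycle_det M (\<beta> - {i}) = cofactor M \<beta> i i" using \<beta> by (simp add: cofactor_diag)
  next
    fix \<beta> assume "\<beta> \<in> {\<beta>. \<beta> \<in> index_sets n k \<and> i \<notin> \<beta>}"
    then have \<beta>: "finite \<beta>" "\<beta> \<subseteq> {..<n}" "card \<beta> = k" "i \<notin> \<beta>" using index_setsD by auto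
    show "insert i \<beta> - {i} = \<beta>" using \<beta> by auto
    show "insert i \<beta> \<in> {\<beta>. \<beta> \<in> index_sets n (Suc k) \<and> i \<in> \<beta>}"
      using \<beta> i by (auto simp: index_sets_def)
  qed
  moreover have "minor_sum M n k =
      (\<Sum>\<beta> | \<beta> \<in> index_sets n k \<and> i \<in> \<beta>. cycle_det M \<beta>) +
      (\<Sum>\<beta> | \<beta> \<in> index_sets n k \<and> i \<notin> \<beta>. cycle_det M \<beta>)"
    unfolding minor_sum_def by (subst sum.union_disjoint[symmetric]) (auto intro: sum.cong)
  ultimately show ?thesis using True by simp
next
  case False
  \<comment> \<open>Sets containing both \<open>i\<close> and \<open>j\<close> drop out by
    \<open>path_det_off_diag\<close>.\<close>
  have "qmmul n (cofactor_sum M n k) M i j =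
      (\<Sum>\<beta> | \<beta> \<in> index_sets n k \<and> i \<in> \<beta> \<and> j \<notin> \<beta>. path_det M \<beta> i (\<lambda>r. M r j))"
    unfolding qmmul_cofactor_sum using index_setsD False
    by (intro sum.mono_neutral_right) (auto intro: path_det_off_diag)
  moreover have "cofactor_sum M n (Suc k) i j =
      (\<Sum>\<beta> | \<beta> \<in> index_sets n (Suc k) \<and> i \<in> \<beta> \<and> j \<in> \<beta>. cofactor M \<beta> i j)"
    unfolding cofactor_sum_def
    by (intro sum.mono_neutral_right) (auto intro: cofactor_notin)
  \<comment> \<open>Deleting \<open>j\<close> matches the remaining terms of the two sums, with
    opposite signs by \<open>cofactor_insert\<close>.\<close>
  moreover have "\<dots> = (\<Sum>\<beta> | \<beta> \<in> index_sets n k \<and> i \<in> \<beta> \<and> j \<notin> \<beta>. - path_det M \<beta> i (\<lambda>r. M r j))"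
  proof (rule sum.reindex_bij_witness[where i = "insert j" and j = "\<lambda>\<beta>. \<beta> - {j}"])
    fix \<beta> assume "\<beta> \<in> {\<beta>. \<beta> \<in> index_sets n (Suc k) \<and> i \<in> \<beta> \<and> j \<in> \<beta>}"
    then have \<beta>: "finite \<beta>" "\<beta> \<subseteq> {..<n}" "card \<beta> = Suc k" "i \<in> \<beta>" "j \<in> \<beta>"
      using index_setsD by auto
    show ins: "insert j (\<beta> - {j}) = \<beta>" using \<beta> by auto
    show "\<beta> - {j} \<in> {\<beta>. \<beta> \<in> index_sets n k \<and> i \<in> \<beta> \<and> j \<notin> \<beta>}"
      using \<beta> False by (auto simp: index_sets_def)
    show "- path_det M (\<beta> - {j}) i (\<lambda>r. M r j) = cofactor M \<beta> i j"
      using cofactor_insert[of "\<beta> - {j}" i j M] \<beta> False unfolding ins by simp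
  next
    fix \<beta> assume "\<beta> \<in> {\<beta>. \<beta> \<in> index_sets n k \<and> i \<in> \<beta> \<and> j \<notin> \<beta>}"
    then have \<beta>: "finite \<beta>" "\<beta> \<subseteq> {..<n}" "card \<beta> = k" "i \<in> \<beta>" "j \<notin> \<beta>"
      using index_setsD by auto
    show "insert j \<beta> - {j} = \<beta>" using \<beta> by auto
    show "insert j \<beta> \<in> {\<beta>. \<beta> \<in> index_sets n (Suc k) \<and> i \<in> \<beta> \<and> j \<in> \<beta>}"
      using \<beta> j by (auto simp: index_sets_def)
  qed
  ultimately show ?thesis using False by (simp add: sum_negf)
qed

section \<open>Inverse permutations and row determinants\<close>

lemma inv_in_orb:
  assumes "permutation \<sigma>" "y \<in> orb \<sigma> s"
  shows "inv \<sigma> y \<in> orb \<sigma> s"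
proof -
  have inj: "inj \<sigma>" using assms(1) permutation_bijective bij_is_inj by blast
  obtain t where t: "y = (\<sigma> ^^ t) s" using assms(2) by (auto simp: orb_def)
  \<comment> \<open>As \<open>s\<close> recurs after \<open>Suc c\<close> steps, one step back from
    \<open>y\<close> is \<open>c\<close> steps forward.\<close>
  obtain c where c: "(\<sigma> ^^ Suc c) s = s"
    using least_power_of_permutation[OF assms(1), of s] by (metis Suc_pred)
  have "y = \<sigma> ((\<sigma> ^^ (t + c)) s)"
    using t c by (metis (no_types, lifting) add_Suc_right comp_apply funpow.simps(2) funpow_add)
  then show ?thesis using inv_f_f[OF inj] by (auto simp: orb_def)
qed

lemma orb_inv:
  assumes "permutation \<sigma>"
  shows "orb (inv \<sigma>) s = orb \<sigma> s"
proof -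
  have sub: "orb (inv \<sigma>) s \<subseteq> orb \<sigma> s" if "permutation \<sigma>" for \<sigma> :: "nat \<Rightarrow> nat"
  proof -
    have "(inv \<sigma> ^^ t) s \<in> orb \<sigma> s" for t
      by (induction t) (simp_all add: orb_self inv_in_orb[OF that])
    then show ?thesis by (auto simp: orb_def[of "inv \<sigma>"])
  qed
  have "orb \<sigma> s \<subseteq> orb (inv \<sigma>) s"
    using sub[OF permutation_inverse[OF assms]] inv_inv_eq[OF permutation_bijective[OF assms]] by simp
  then show ?thesis using sub[OF assms] by blast
qed

text \<open>The inverse permutation runs through the cycle backwards, while conjugation reverses the
  product and \<open>qct\<close> reverses each edge.\<close>

lemma cyc_prod_qct_inv:
  assumes "permutation \<sigma>"
  shows "cyc_prod (qct M) (inv \<sigma>) s = qcnj (cyc_prod M \<sigma> s)"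
proof -
  define c where "c = least_power \<sigma> s"
  have inj: "inj \<sigma>" using assms permutation_bijective bij_is_inj by blast
  have pow: "(inv \<sigma> ^^ t) s = (\<sigma> ^^ (c - t)) s" if "t \<le> c" for t
    using that
  proof (induction t)
    case 0
    then show ?case using least_power_of_permutation(1)[OF assms] c_def by simp
  next
    case (Suc t)
    then have "c - t = Suc (c - Suc t)" by simp
    then show ?case using Suc inv_f_f[OF inj] by simp
  qed
  have "map (\<lambda>t. qct M ((inv \<sigma> ^^ t) s) ((inv \<sigma> ^^ Suc t) s)) [0..<c] =
      rev (map qcnj (map (\<lambda>t. M ((\<sigma> ^^ t) s) ((\<sigma> ^^ Suc t) s)) [0..<c]))"
  proof (rule nth_equalityI)
    fix t
    assume "t < length (map (\<lambda>t. qct M ((inv \<sigma> ^^ t) s) ((inv \<sigma> ^^ Suc t) s)) [0..<c])"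
    then have t: "t < c" by simp
    then have "Suc (c - Suc t) = c - t" by simp
    then show "map (\<lambda>t. qct M ((inv \<sigma> ^^ t) s) ((inv \<sigma> ^^ Suc t) s)) [0..<c] ! t =
        rev (map qcnj (map (\<lambda>t. M ((\<sigma> ^^ t) s) ((\<sigma> ^^ Suc t) s)) [0..<c])) ! t"
      using t pow[of t] pow[of "Suc t"] by (simp add: rev_nth qct_def del: funpow.simps)
  qed simp
  then show ?thesis
    unfolding cyc_prod_def qprod_list_eq_prod_list qcnj_prod_list orb_inv[OF assms]
      card_orb[OF assms] c_def[symmetric] by simp
qed

text \<open>Inverse permutations have the same orbits, hence the same signs and representatives.
  Conjugation moves the distinguished cycle from last to first place and turns the decreasing order
  into the increasing one.\<close>

lemma rdet_on_eq_qcnj_cdet_on: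
  assumes fin: "finite I"
  shows "rdet_on I i M = qcnj (cdet_on I i (qct M))"
  unfolding rdet_on_def cdet_on_def qcnj_sum qprod_list_eq_prod_list
proof (rule sum.reindex_bij_witness[where i = inv and j = inv])
  fix \<sigma> assume "\<sigma> \<in> {\<sigma>. \<sigma> permutes I}"
  then have \<sigma>: "\<sigma> permutes I" by simp
  then have perm: "permutation \<sigma>" using fin permutation_permutes by blast
  have reps: "cyc_reps I (inv \<sigma>) = cyc_reps I \<sigma>" by (simp add: cyc_reps_def orb_inv[OF perm])
  show "inv (inv \<sigma>) = \<sigma>" using \<sigma> by (rule permutes_inv_inv)
  show "inv \<sigma> \<in> {\<sigma>. \<sigma> permutes I}" using permutes_inv[OF \<sigma>] by simp
  show "qcnj ((-1) ^ (card I - card (cyc_reps I (inv \<sigma>))) *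
         (prod_list (map (cyc_prod (qct M) (inv \<sigma>))
            (rev (sorted_list_of_set (cyc_reps I (inv \<sigma>) - {Min (orb (inv \<sigma>) i)})))) *
          cyc_prod (qct M) (inv \<sigma>) i)) =
        (-1) ^ (card I - card (cyc_reps I \<sigma>)) *
         (cyc_prod M \<sigma> i *
          prod_list (map (cyc_prod M \<sigma>) (sorted_list_of_set (cyc_reps I \<sigma> - {Min (orb \<sigma> i)}))))"
    using neg_one_power_left_commute[of "cyc_prod M \<sigma> i *
          prod_list (map (cyc_prod M \<sigma>) (sorted_list_of_set (cyc_reps I \<sigma> - {Min (orb \<sigma> i)})))"
        "card I - card (cyc_reps I \<sigma>)" 1]
    by (simp add: qcnj_mult qcnj_prod_list rev_map[symmetric] comp_def reps orb_inv[OF perm]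
        cyc_prod_qct_inv[OF perm])
qed (auto intro: permutes_inv permutes_inv_inv)

lemma (in hermitian) hdet_on_eq_cycle_det:
  assumes "finite I" "I \<noteq> {}"
  shows "hdet_on I M = cycle_det M I"
proof -
  have "qct M = M" by (simp add: qct_def hermitian)
  then have "hdet_on I M = qcnj (cycle_det M I)"
    unfolding hdet_on_def by (simp add: rdet_on_eq_qcnj_cdet_on cdet_on_Min assms)
  moreover obtain d where "cycle_det M I = of_real d" using cycle_det_real[OF assms(1)] by blast
  ultimately show ?thesis by simp
qed

section \<open>Rank\<close>

text \<open>Gaussian elimination, one equation and one unknown at a time; coefficients stand on the
  left, so rows are combined by left multiples.\<close>

lemma homogeneous_system_nontrivial:
  fixes B :: "'p \<Rightarrow> 'c \<Rightarrow> 'a :: division_ring"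
  assumes "finite P" "finite T" "card P < card T"
  shows "\<exists>w. (\<exists>c\<in>T. w c \<noteq> 0) \<and> (\<forall>p\<in>P. (\<Sum>c\<in>T. B p c * w c) = 0)"
  using assms
proof (induction P arbitrary: B T rule: finite_induct)
  case empty
  then have "T \<noteq> {}" by auto
  then show ?case by (intro exI[of _ "\<lambda>_. 1"]) auto
next
  case (insert p P)
  then have card: "Suc (card P) < card T" by simp
  show ?case
  proof (cases "\<forall>c\<in>T. B p c = 0")
    case True
    obtain w where "\<exists>c\<in>T. w c \<noteq> 0" "\<forall>q\<in>P. (\<Sum>c\<in>T. B q c * w c) = 0"
      using insert.IH[OF insert.prems(1), of B] card by auto
    then show ?thesis using True by (intro exI[of _ w]) auto
  next
    case False
    then obtain c0 where c0: "c0 \<in> T" "B p c0 \<noteq> 0" by auto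
    let ?T = "T - {c0}"
    have fin: "finite ?T" and card': "card P < card ?T" using insert.prems(1) card c0(1) by simp_all
    \<comment> \<open>A left multiple of row \<open>p\<close> is subtracted from each other row to
      clear the pivot column \<open>c0\<close>.\<close>
    obtain w where w: "\<exists>c\<in>?T. w c \<noteq> 0"
      "\<forall>q\<in>P. (\<Sum>c\<in>?T. (B q c - B q c0 * inverse (B p c0) * B p c) * w c) = 0"
      using insert.IH[OF fin card', of "\<lambda>q c. B q c - B q c0 * inverse (B p c0) * B p c"] by blast
    define S where "S = (\<Sum>c\<in>?T. B p c * w c)"
    \<comment> \<open>Back substitution: the value at \<open>c0\<close> is the one forced by
      equation \<open>p\<close>.\<close>
    define w' where "w' = (\<lambda>c. if c = c0 then - (inverse (B p c0) * S) else w c)"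
    have sum: "(\<Sum>c\<in>T. B q c * w' c) =
        (\<Sum>c\<in>?T. B q c * w c) - B q c0 * inverse (B p c0) * S" for q
    proof -
      have "(\<Sum>c\<in>?T. B q c * w' c) = (\<Sum>c\<in>?T. B q c * w c)"
        by (intro sum.cong) (auto simp: w'_def)
      then show ?thesis
        using sum.remove[OF insert.prems(1) c0(1), of "\<lambda>c. B q c * w' c"]
        by (simp add: w'_def mult.assoc)
    qed
    have "(\<Sum>c\<in>T. B q c * w' c) = 0" if "q \<in> P" for q
      using w(2) that unfolding sum S_def
      by (simp add: left_diff_distrib sum_subtractf sum_distrib_left mult.assoc)
    moreover have "(\<Sum>c\<in>T. B p c * w' c) = 0"
      unfolding sum using c0 by (simp add: S_def[symmetric])
    moreover have "\<exists>c\<in>T. w' c \<noteq> 0" using w(1) by (auto simp: w'_def)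
    ultimately show ?thesis by blast
  qed
qed

lemma finite_indep_cards: "finite {card S | S. S \<subseteq> {..<n} \<and> right_indep_cols m A S}"
  by (rule finite_subset[of _ "card ` Pow {..<n}"]) auto

lemma card_le_qrank: "S \<subseteq> {..<n} \<Longrightarrow> right_indep_cols m A S \<Longrightarrow> card S \<le> qrank m n A"
  unfolding qrank_def by (rule Max_ge[OF finite_indep_cards]) auto

lemma qrank_attained:
  obtains S where "S \<subseteq> {..<n}" "right_indep_cols m A S" "card S = qrank m n A"
proof -
  have "right_indep_cols m A {}" by (simp add: right_indep_cols_def)
  then have "{card S | S. S \<subseteq> {..<n} \<and> right_indep_cols m A S} \<noteq> {}" by blast
  from Max_in[OF finite_indep_cards this] show ?thesis
    unfolding qrank_def[symmetric] using that by auto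
qed

text \<open>A relation on \<open>S\<close> extends by zero to \<open>T\<close>.\<close>

lemma right_indep_cols_subset:
  assumes "right_indep_cols m A T" "S \<subseteq> T" "finite T"
  shows "right_indep_cols m A S"
  unfolding right_indep_cols_def
proof (intro allI impI ballI)
  fix w c assume w: "\<forall>r<m. (\<Sum>c\<in>S. A r c * w c) = 0" and c: "c \<in> S"
  let ?w = "\<lambda>c. if c \<in> S then w c else 0"
  have "(\<Sum>c\<in>T. A r c * ?w c) = (\<Sum>c\<in>S. A r c * w c)" for r
    using assms by (intro sum.mono_neutral_cong_right) auto
  then have "\<forall>r<m. (\<Sum>c\<in>T. A r c * ?w c) = 0" using w by simp
  then have "\<forall>c\<in>T. ?w c = 0" by (rule assms(1)[unfolded right_indep_cols_def, THEN spec, THEN mp])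
  from bspec[OF this, of c] show "w c = 0" using c assms(2) by (simp add: subset_iff)
qed

text \<open>\<open>S\<close> has maximal size, so a further column \<open>c\<close> creates a
  nontrivial relation. Its coefficient at \<open>c\<close> is nonzero since \<open>S\<close> is
  independent, and dividing by it on the right solves for the column.\<close>

lemma columns_in_span:
  assumes S: "S \<subseteq> {..<n}" "right_indep_cols m A S" "card S = qrank m n A" and c: "c < n"
  shows "\<exists>b. \<forall>l<m. A l c = (\<Sum>s\<in>S. A l s * b s)"
proof (cases "c \<in> S")
  case True
  have "finite S" using S(1) finite_subset by blast
  then show ?thesis
    using True by (intro exI[of _ "\<lambda>s. if s = c then 1 else 0"]) (simp add: if_distrib cong: if_cong)
next
  case False
  have fin: "finite S" using S(1) finite_subset by blast
  have "\<not> right_indep_cols m A (insert c S)"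
    using card_le_qrank[of "insert c S" n m A] S c False fin by auto
  then obtain w d where w: "\<forall>r<m. (\<Sum>c\<in>insert c S. A r c * w c) = 0" "d \<in> insert c S" "w d \<noteq> 0"
    unfolding right_indep_cols_def by blast
  then have eq: "\<forall>r<m. A r c * w c = - (\<Sum>s\<in>S. A r s * w s)"
    using False fin by (simp add: add_eq_0_iff2)
  have wc: "w c \<noteq> 0"
  proof
    assume "w c = 0"
    then have "\<forall>s\<in>S. w s = 0" using eq S(2) unfolding right_indep_cols_def by simp
    then show False using w \<open>w c = 0\<close> by auto
  qed
  show ?thesis
  proof (intro exI allI impI)
    fix l assume "l < m"
    have "A l c = (A l c * w c) * inverse (w c)" using wc by (simp add: mult.assoc)
    also have "\<dots> = (\<Sum>s\<in>S. A l s * - (w s * inverse (w c)))"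
      using eq \<open>l < m\<close> by (simp add: sum_distrib_right mult.assoc sum_negf)
    finally show "A l c = (\<Sum>s\<in>S. A l s * - (w s * inverse (w c)))" .
  qed
qed

text \<open>If \<open>T\<close> were larger than \<open>S\<close>, some nonzero \<open>w\<close> on
  \<open>T\<close> would be killed by the rows of \<open>qct A\<close> indexed by \<open>S\<close>.
  All rows are left combinations of these, so \<open>w\<close> would be a relation between the
  columns in \<open>T\<close>.\<close>

lemma qrank_qct_le: "qrank n m (qct A) \<le> qrank m n A"
proof -
  obtain S where S: "S \<subseteq> {..<n}" "right_indep_cols m A S" "card S = qrank m n A"
    by (rule qrank_attained)
  obtain T where T: "T \<subseteq> {..<m}" "right_indep_cols n (qct A) T" "card T = qrank n m (qct A)"
    by (rule qrank_attained)
  have fin: "finite S" "finite T" using S(1) T(1) finite_subset by blast+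
  show ?thesis
  proof (rule ccontr)
    assume "\<not> ?thesis"
    then have "card S < card T" using S T by simp
    then obtain w where w: "\<exists>t\<in>T. w t \<noteq> 0" "\<forall>s\<in>S. (\<Sum>t\<in>T. qct A s t * w t) = 0"
      using homogeneous_system_nontrivial[OF fin, of "qct A"] by auto
    have "(\<Sum>t\<in>T. qct A c t * w t) = 0" if c: "c < n" for c
    proof -
      obtain b where b: "\<forall>l<m. A l c = (\<Sum>s\<in>S. A l s * b s)"
        using columns_in_span[OF S c] by auto
      have "(\<Sum>t\<in>T. qct A c t * w t) = (\<Sum>t\<in>T. \<Sum>s\<in>S. qcnj (b s) * (qct A s t * w t))"
        using b T(1)
        by (intro sum.cong refl)
           (auto simp: qct_def qcnj_sum qcnj_mult sum_distrib_right mult.assoc)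
      also have "\<dots> = (\<Sum>s\<in>S. qcnj (b s) * (\<Sum>t\<in>T. qct A s t * w t))"
        by (subst sum.swap) (simp add: sum_distrib_left)
      also have "\<dots> = 0" using w(2) by simp
      finally show ?thesis .
    qed
    then show False using T(2) w(1) unfolding right_indep_cols_def by blast
  qed
qed

lemma qrank_qct: "qrank n m (qct A) = qrank m n A"
  using qrank_qct_le[of n m A] qrank_qct_le[of m n "qct A"] by simp

section \<open>Gram matrices\<close>

locale gram =
  fixes m n :: nat and A :: qmat
begin

abbreviation "H \<equiv> qmmul m (qct A) A"

sublocale hermitian H
proof
  fix r c
  have "qcnj (H r c) = qct H c r" by (simp add: qct_def)
  then show "qcnj (H r c) = H c r" by (simp add: qct_qmmul)
qed

lemma cofactor_row:
  assumes "finite \<beta>" "i \<in> \<beta>" "j \<in> \<beta>"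
  shows "(\<Sum>k\<in>\<beta>. cofactor H \<beta> i k * H k j) = (if i = j then cycle_det H \<beta> else 0)"
  using path_det_expand[OF assms(1,2), of H "\<lambda>r. H r j"] path_det_diag[OF assms(1,2)]
    path_det_off_diag[OF assms] by auto

lemma gram_vec:
  "(\<Sum>j\<in>\<beta>. (\<Sum>k\<in>\<beta>. c k * H k j) * w j) =
    (\<Sum>l<m. (\<Sum>k\<in>\<beta>. c k * qcnj (A l k)) * (\<Sum>j\<in>\<beta>. A l j * w j))"
proof -
  have "(\<Sum>j\<in>\<beta>. (\<Sum>k\<in>\<beta>. c k * H k j) * w j) =
      (\<Sum>j\<in>\<beta>. \<Sum>k\<in>\<beta>. \<Sum>l<m. c k * qcnj (A l k) * (A l j * w j))"
    by (simp add: qmmul_def qct_def sum_distrib_left sum_distrib_right mult.assoc)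
  also have "\<dots> = (\<Sum>j\<in>\<beta>. \<Sum>l<m. \<Sum>k\<in>\<beta>. c k * qcnj (A l k) * (A l j * w j))"
    by (intro sum.cong refl sum.swap)
  also have "\<dots> = (\<Sum>l<m. \<Sum>j\<in>\<beta>. \<Sum>k\<in>\<beta>. c k * qcnj (A l k) * (A l j * w j))"
    by (rule sum.swap)
  also have "\<dots> = (\<Sum>l<m. (\<Sum>k\<in>\<beta>. c k * qcnj (A l k)) * (\<Sum>j\<in>\<beta>. A l j * w j))"
    by (simp add: sum_distrib_left sum_distrib_right)
  finally show ?thesis .
qed

text \<open>The cofactor row times \<open>H\<close> is the determinant times a unit row; factoring
  \<open>H\<close> brings in the vector \<open>A w\<close>, so that column relations and norms can
  be used.\<close>

lemma cofactor_row_vec: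
  assumes "finite \<beta>" "i \<in> \<beta>"
  shows "(\<Sum>l<m. (\<Sum>k\<in>\<beta>. cofactor H \<beta> i k * qcnj (A l k)) * (\<Sum>j\<in>\<beta>. A l j * w j)) =
    cycle_det H \<beta> * w i"
proof -
  have "(\<Sum>j\<in>\<beta>. (\<Sum>k\<in>\<beta>. cofactor H \<beta> i k * H k j) * w j) =
      (\<Sum>j\<in>\<beta>. if i = j then cycle_det H \<beta> * w j else 0)"
    by (intro sum.cong refl) (simp add: cofactor_row[OF assms])
  then show ?thesis unfolding gram_vec using assms by (simp add: sum.delta)
qed

lemma cycle_det_dependent:
  assumes fin: "finite \<beta>" and "\<not> right_indep_cols m A \<beta>"
  shows "cycle_det H \<beta> = 0"
proof -
  obtain w i where w: "\<forall>r<m. (\<Sum>c\<in>\<beta>. A r c * w c) = 0" "i \<in> \<beta>" "w i \<noteq> 0"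
    using assms(2) unfolding right_indep_cols_def by blast
  then have "cycle_det H \<beta> * w i = 0"
    using cofactor_row_vec[OF fin w(2), of w] by simp
  then show ?thesis using w(3) by simp
qed

text \<open>Let \<open>?v\<close> be the conjugated cofactor row of \<open>i\<close> and
  \<open>?u\<close> its image under \<open>A\<close>. The squared norm of \<open>?u\<close> is
  \<open>d * p\<close>, the new determinant times the previous one. It is nonzero because
  \<open>?v i\<close> is \<open>p > 0\<close> and the columns are independent.\<close>

lemma cycle_det_pos:
  assumes "finite \<beta>" "right_indep_cols m A \<beta>"
  shows "qr (cycle_det H \<beta>) > 0"
  using assms
proof (induction \<beta> rule: finite_induct)
  case (insert i \<beta>)
  let ?I = "insert i \<beta>"
  let ?v = "\<lambda>k. qcnj (cofactor H ?I i k)"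
  let ?u = "\<lambda>l. \<Sum>j\<in>?I. A l j * ?v j"
  obtain d p where d: "cycle_det H ?I = of_real d" and p: "cycle_det H \<beta> = of_real p"
    using cycle_det_real insert.hyps(1) finite.insertI by meson
  have "right_indep_cols m A \<beta>"
    using right_indep_cols_subset[OF insert.prems] insert.hyps(1) by blast
  then have p_pos: "p > 0" using insert.IH p by simp
  have v: "?v i = of_real p"
    using cofactor_diag[of ?I H i] insert.hyps p by simp
  have "qcnj (?u l) = (\<Sum>k\<in>?I. cofactor H ?I i k * qcnj (A l k))" for l
    by (simp add: qcnj_sum qcnj_mult qcnj_add insert.hyps)
  then have eq: "qr (\<Sum>l<m. qcnj (?u l) * ?u l) = d * p"
    using cofactor_row_vec[of ?I i ?v] insert.hyps(1) unfolding d v by simp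
  have "d * p \<noteq> 0"
  proof
    assume "d * p = 0"
    then have "\<forall>l<m. ?u l = 0"
      using sum_qcnj_mult_self_eq_0[of "{..<m}" ?u] eq by simp
    then have "\<forall>k\<in>?I. ?v k = 0"
      by (rule insert.prems[unfolded right_indep_cols_def, THEN spec, THEN mp])
    then have "?v i = 0" by (rule bspec) simp
    then show False using v p_pos by simp
  qed
  moreover have "d * p \<ge> 0" using eq sum_qcnj_mult_self_nonneg[of ?u "{..<m}"] by simp
  ultimately have "d * p > 0" by linarith
  then have "d > 0" using p_pos zero_less_mult_pos2 by blast
  then show ?case by (simp add: d)
qed simp

text \<open>All summands are nonnegative, and an independent set attaining the rank contributes a
  positive one.\<close>

lemma minor_sum_rank:
  obtains d where "minor_sum H n (qrank m n A) = of_real d" "d > 0"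
proof -
  let ?d = "\<Sum>\<beta>\<in>index_sets n (qrank m n A). qr (cycle_det H \<beta>)"
  have "minor_sum H n (qrank m n A) = of_real ?d"
    unfolding minor_sum_def of_real_sum using index_setsD cycle_det_real
    by (intro sum.cong refl) blast
  moreover have "?d > 0"
  proof -
    obtain S where S: "S \<subseteq> {..<n}" "right_indep_cols m A S" "card S = qrank m n A"
      by (rule qrank_attained)
    have fin: "finite S" using S(1) finite_subset by blast
    have nonneg: "qr (cycle_det H \<beta>) \<ge> 0" if "\<beta> \<in> index_sets n (qrank m n A)" for \<beta>
      using cycle_det_pos[of \<beta>] cycle_det_dependent[of \<beta>] index_setsD[OF that]
      by (cases "right_indep_cols m A \<beta>") (auto intro: less_imp_le)
    have "qr (cycle_det H S) \<le> ?d"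
      using S nonneg by (intro member_le_sum) (auto simp: index_sets_def)
    then show ?thesis using cycle_det_pos[OF fin S(2)] by simp
  qed
  ultimately show ?thesis using that by blast
qed

lemma minor_sum_above_rank: "qrank m n A < k \<Longrightarrow> minor_sum H n k = 0"
  unfolding minor_sum_def
proof (intro sum.neutral ballI)
  fix \<beta> assume k: "qrank m n A < k" and \<beta>: "\<beta> \<in> index_sets n k"
  then have "\<not> right_indep_cols m A \<beta>"
    using card_le_qrank[of \<beta> n m A] index_setsD[OF \<beta>] by auto
  then show "cycle_det H \<beta> = 0" using cycle_det_dependent index_setsD[OF \<beta>] by blast
qed

end

text \<open>\<open>U B B\<^sup>* = 0\<close> forces \<open>(U B) (U B)\<^sup>* = 0\<close>, hence \<open>U B = 0\<close>.\<close>
lemma qmmul_gram_cancel: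
  assumes "\<And>p. p < q \<Longrightarrow> qmmul k (qmmul q U B) (qct B) i p = 0" and j: "j < k"
  shows "qmmul q U B i j = 0"
proof -
  let ?W = "qmmul q U B"
  have "(\<Sum>l<k. qcnj (qcnj (?W i l)) * qcnj (?W i l)) = qmmul k ?W (qct ?W) i i"
    by (simp add: qmmul_def[of k] qct_def)
  also have "\<dots> = qmmul q (qmmul k ?W (qct B)) (qct U) i i"
    by (simp add: qct_qmmul qmmul_assoc)
  also have "\<dots> = 0" using assms by (simp add: qmmul_def[of q _ "qct U"])
  finally have "qcnj (?W i j) = 0"
    using sum_qcnj_mult_self_eq_0[of "{..<k}" "\<lambda>l. qcnj (?W i l)" j] j by simp
  then show ?thesis by simp
qed

section \<open>Descent above the rank and the Moore-Penrose inverse\<close>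

context gram
begin

abbreviation "C \<equiv> cofactor_sum H n"

lemma cofactor_sum_annihilates:
  assumes "qrank m n A < k" "i < n" "p < m"
  shows "qmmul n (C k) (qct A) i p = 0"
  using assms
proof (induction "Suc n - k" arbitrary: k i p)
  case 0
  \<comment> \<open>The truncated difference vanishes just when \<open>k > n\<close>, and then no
    index set has size \<open>k\<close>.\<close>
  have "\<beta> \<notin> index_sets n k" for \<beta>
    using 0(1) index_setsD[of \<beta> n k] card_mono[of "{..<n}" \<beta>] by auto
  then show ?case by (simp add: qmmul_def cofactor_sum_def)
next
  case (Suc x)
  let ?U = "qmmul n (C k) (qct A)"
  have "qmmul n (C k) H i j = - C (Suc k) i j" if "j < n" for j
    using cofactor_sum_recurrence[OF Suc.prems(2) that, of k] minor_sum_above_rank[OF Suc.prems(1)]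
    by (simp add: eq_neg_iff_add_eq_0)
  then have "qmmul n (qmmul m ?U A) (qct A) i q = - qmmul n (C (Suc k)) (qct A) i q" for q
    unfolding qmmul_assoc[of m n "C k"] by (simp add: qmmul_def[of n _ "qct A"] sum_negf)
  then have "qmmul n (qmmul m ?U A) (qct A) i q = 0" if "q < m" for q
    using Suc.hyps(1)[of "Suc k" i q] Suc.hyps(2) Suc.prems that by simp
  \<comment> \<open>First cancellation, with \<open>B = A\<close>: from
    \<open>C k A* A A* = 0\<close> to \<open>C k A* A = 0\<close>.\<close>
  then have "qmmul m ?U A i j = 0" if "j < n" for j
    using that by (rule qmmul_gram_cancel)
  \<comment> \<open>Second cancellation, with \<open>B = qct A\<close>.\<close>
  then show ?case
    using Suc.prems(3) qmmul_gram_cancel[of n m "C k" "qct A" i p] by simp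
qed

theorem MP_inverse_cofactor_sum:
  assumes MP: "is_MP_inverse m n A X" and i: "i < n" and j: "j < m"
  shows "qmmul n (C (qrank m n A)) (qct A) i j = minor_sum H n (qrank m n A) * X i j"
proof -
  let ?r = "qrank m n A"
  have AXA: "\<And>i j. i < m \<Longrightarrow> j < n \<Longrightarrow> qmmul m (qmmul n A X) A i j = A i j"
    and XAX: "\<And>i j. i < n \<Longrightarrow> j < m \<Longrightarrow> qmmul n (qmmul m X A) X i j = X i j"
    and AX: "\<And>i j. i < m \<Longrightarrow> j < m \<Longrightarrow> qct (qmmul n A X) i j = qmmul n A X i j"
    and XA: "\<And>i j. i < n \<Longrightarrow> j < n \<Longrightarrow> qct (qmmul m X A) i j = qmmul m X A i j"
    using MP unfolding is_MP_inverse_def by blast+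
  \<comment> \<open>\<open>A* = (A X A)* = A* (A X)* = A* A X\<close>, as \<open>A X\<close> is
    Hermitian.\<close>
  have A_eq: "qct A l j = qmmul n H X l j" if l: "l < n" for l
  proof -
    have "qct A l j = qct (qmmul m (qmmul n A X) A) l j"
      using AXA[OF j l] by (simp add: qct_def)
    also have "\<dots> = qmmul m (qct A) (qmmul n A X) l j"
      unfolding qct_qmmul[of m] by (rule qmmul_cong) (simp_all add: AX j)
    finally show ?thesis by (simp add: qmmul_assoc)
  qed
  \<comment> \<open>\<open>X = (X A)* X = A* X* X\<close>, so whatever annihilates
    \<open>qct A\<close> from the left annihilates \<open>X\<close>.\<close>
  have X_eq: "X l j = qmmul n (qmmul m (qct A) (qct X)) X l j" if l: "l < n" for l
  proof -
    have "X l j = qmmul n (qmmul m X A) X l j" using XAX[OF l j] by simp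
    also have "\<dots> = qmmul n (qct (qmmul m X A)) X l j"
      by (rule qmmul_cong) (simp_all add: XA l)
    finally show ?thesis by (simp add: qct_qmmul)
  qed
  have "qmmul n (C (Suc ?r)) X i j = qmmul n (C (Suc ?r)) (qmmul n (qmmul m (qct A) (qct X)) X) i j"
    using X_eq by (intro qmmul_cong) simp_all
  also have "\<dots> = qmmul n (qmmul m (qmmul n (C (Suc ?r)) (qct A)) (qct X)) X i j"
    by (simp add: qmmul_assoc)
  also have "\<dots> = 0"
    using cofactor_sum_annihilates[of "Suc ?r" i] i
    by (simp add: qmmul_def[of n _ X] qmmul_def[of m _ "qct X"])
  finally have CX: "qmmul n (C (Suc ?r)) X i j = 0" .
  have "qmmul n (C ?r) (qct A) i j = qmmul n (C ?r) (qmmul n H X) i j"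
    using A_eq by (intro qmmul_cong) simp_all
  also have "\<dots> = qmmul n (qmmul n (C ?r) H) X i j" by (simp add: qmmul_assoc)
  also have "\<dots> = (\<Sum>l<n. ((if i = l then minor_sum H n ?r else 0) - C (Suc ?r) i l) * X l j)"
    unfolding qmmul_def[of n _ X]
    by (intro sum.cong refl) (simp add: cofactor_sum_recurrence[OF i, of _ ?r, symmetric])
  also have "\<dots> = (\<Sum>l<n. if i = l then minor_sum H n ?r * X l j else 0) - qmmul n (C (Suc ?r)) X i j"
    unfolding qmmul_def[of n _ X] sum_subtractf[symmetric]
    by (intro sum.cong refl) (simp add: left_diff_distrib)
  also have "\<dots> = minor_sum H n ?r * X i j" using CX i by (simp add: sum.delta)
  finally show ?thesis .
qed

text \<open>Realness of the denominator is recorded alongside the formula so that the formula can be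
  conjugated.\<close>

theorem MP_inverse_cdet:
  assumes rank_pos: "qrank m n A \<ge> 1"
    and MP: "is_MP_inverse m n A X" and i: "i < n" and j: "j < m"
  shows "X i j =
      (\<Sum>\<beta> | \<beta> \<subseteq> {..<n} \<and> card \<beta> = qrank m n A \<and> i \<in> \<beta>.
          cdet_on \<beta> i (repl_col H i (\<lambda>r. qct A r j)))
      * qinv (\<Sum>\<beta> | \<beta> \<subseteq> {..<n} \<and> card \<beta> = qrank m n A. hdet_on \<beta> H)"
    and "qcnj (\<Sum>\<beta> | \<beta> \<subseteq> {..<n} \<and> card \<beta> = qrank m n A. hdet_on \<beta> H) =
      (\<Sum>\<beta> | \<beta> \<subseteq> {..<n} \<and> card \<beta> = qrank m n A. hdet_on \<beta> H)"
proof -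
  obtain d where d: "minor_sum H n (qrank m n A) = of_real d" "d > 0" by (rule minor_sum_rank)
  have "(\<Sum>\<beta> | \<beta> \<subseteq> {..<n} \<and> card \<beta> = qrank m n A. hdet_on \<beta> H) = minor_sum H n (qrank m n A)"
    unfolding minor_sum_def index_sets_def
  proof (intro sum.cong refl hdet_on_eq_cycle_det)
    fix \<beta> assume \<beta>: "\<beta> \<in> {\<beta>. \<beta> \<subseteq> {..<n} \<and> card \<beta> = qrank m n A}"
    then show "finite \<beta>" using finite_subset by blast
    \<comment> \<open>Rank at least 1 keeps the index sets nonempty, so the \<open>Min\<close> in
      \<open>hdet_on\<close> is a genuine index.\<close>
    show "\<beta> \<noteq> {}" using \<beta> rank_pos by auto
  qed
  then have denom: "(\<Sum>\<beta> | \<beta> \<subseteq> {..<n} \<and> card \<beta> = qrank m n A. hdet_on \<beta> H) = of_real d"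
    using d by simp
  then show "qcnj (\<Sum>\<beta> | \<beta> \<subseteq> {..<n} \<and> card \<beta> = qrank m n A. hdet_on \<beta> H) =
      (\<Sum>\<beta> | \<beta> \<subseteq> {..<n} \<and> card \<beta> = qrank m n A. hdet_on \<beta> H)" by simp
  have "(\<Sum>\<beta> | \<beta> \<subseteq> {..<n} \<and> card \<beta> = qrank m n A \<and> i \<in> \<beta>.
      cdet_on \<beta> i (repl_col H i (\<lambda>r. qct A r j))) =
    (\<Sum>\<beta> | \<beta> \<in> index_sets n (qrank m n A) \<and> i \<in> \<beta>. path_det H \<beta> i (\<lambda>r. qct A r j))"
    using finite_subset
    by (intro sum.cong cdet_on_repl_col) (auto simp: index_sets_def)
  also have "\<dots> = of_real d * X i j"
    unfolding qmmul_cofactor_sum[symmetric] using MP_inverse_cofactor_sum[OF MP i j] d by simp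
  finally have num: "(\<Sum>\<beta> | \<beta> \<subseteq> {..<n} \<and> card \<beta> = qrank m n A \<and> i \<in> \<beta>.
      cdet_on \<beta> i (repl_col H i (\<lambda>r. qct A r j))) = X i j * of_real d"
    by (simp add: of_real_quat_commute)
  show "X i j =
      (\<Sum>\<beta> | \<beta> \<subseteq> {..<n} \<and> card \<beta> = qrank m n A \<and> i \<in> \<beta>.
          cdet_on \<beta> i (repl_col H i (\<lambda>r. qct A r j)))
      * qinv (\<Sum>\<beta> | \<beta> \<subseteq> {..<n} \<and> card \<beta> = qrank m n A. hdet_on \<beta> H)"
    unfolding num denom inverse_quat_def[symmetric] using d(2) by (simp add: mult.assoc)
qed

end

section \<open>The row formula by conjugate transposition\<close>

lemma is_MP_inverse_qct:
  assumes "is_MP_inverse m n A X"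
  shows "is_MP_inverse n m (qct A) (qct X)"
proof -
  \<comment> \<open>Transposition preserves the first two Penrose equations and exchanges the two
    symmetry conditions.\<close>
  have "qmmul n (qmmul m (qct A) (qct X)) (qct A) = qct (qmmul m (qmmul n A X) A)"
    "qmmul m (qmmul n (qct X) (qct A)) (qct X) = qct (qmmul n (qmmul m X A) X)"
    "qmmul m (qct A) (qct X) = qct (qmmul m X A)" "qmmul n (qct X) (qct A) = qct (qmmul n A X)"
    by (simp_all add: qct_qmmul qmmul_assoc)
  then show ?thesis
    using assms unfolding is_MP_inverse_def by (simp add: qct_def)
qed

lemma qcnj_qinv: "qcnj (qinv x) = qinv (qcnj x)"
  by (simp add: qcnj_def qinv_def Let_def)

theorem theorem4p1:
  fixes m n :: nat and A X :: qmat and i j :: nat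
  assumes rank_pos: "qrank m n A \<ge> 1"
    and MP: "is_MP_inverse m n A X"
    and i: "i < n" and j: "j < m"
  shows "(X i j =
      (\<Sum>\<beta> | \<beta> \<subseteq> {..<n} \<and> card \<beta> = qrank m n A \<and> i \<in> \<beta>.
          cdet_on \<beta> i (repl_col (qmmul m (qct A) A) i (\<lambda>r. qct A r j)))
      * qinv (\<Sum>\<beta> | \<beta> \<subseteq> {..<n} \<and> card \<beta> = qrank m n A.
          hdet_on \<beta> (qmmul m (qct A) A))) \<and>
    (X i j =
      (\<Sum>\<alpha> | \<alpha> \<subseteq> {..<m} \<and> card \<alpha> = qrank m n A \<and> j \<in> \<alpha>.
          rdet_on \<alpha> j (repl_row (qmmul n A (qct A)) j (\<lambda>c. qct A i c)))
      * qinv (\<Sum>\<alpha> | \<alpha> \<subseteq> {..<m} \<and> card \<alpha> = qrank m n A.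
          hdet_on \<alpha> (qmmul n A (qct A))))"
proof (rule conjI[OF gram.MP_inverse_cdet(1)[OF assms]])
  let ?K = "qmmul n A (qct A)"
  let ?N = "\<Sum>\<alpha> | \<alpha> \<subseteq> {..<m} \<and> card \<alpha> = qrank m n A \<and> j \<in> \<alpha>.
      cdet_on \<alpha> j (repl_col ?K j (\<lambda>r. A r i))"
  let ?D = "\<Sum>\<alpha> | \<alpha> \<subseteq> {..<m} \<and> card \<alpha> = qrank m n A. hdet_on \<alpha> ?K"
  have "qrank n m (qct A) \<ge> 1" using rank_pos by (simp add: qrank_qct)
  \<comment> \<open>The column formula for \<open>qct A\<close>, whose Gram matrix is
    \<open>?K\<close> and whose rank is that of \<open>A\<close>; \<open>i\<close> and
    \<open>j\<close> trade places.\<close>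
  note dual = gram.MP_inverse_cdet[OF this is_MP_inverse_qct[OF MP] j i, unfolded qrank_qct qct_qct]
  define N where "N = ?N"
  define D where "D = ?D"
  have X: "qct X j i = N * qinv D" unfolding N_def D_def by (rule dual(1))
  have D_real: "qcnj D = D" unfolding D_def by (rule dual(2))
  define d where "d = qr D"
  have D: "D = of_real d" unfolding d_def using D_real by (rule qcnj_fixed_imp_real)
  \<comment> \<open>Row \<open>i\<close> of \<open>qct A\<close> conjugates to column
    \<open>i\<close> of \<open>A\<close>, the replacement column in \<open>?N\<close>.\<close>
  have "qct (repl_row ?K j (\<lambda>c. qct A i c)) = repl_col (qct ?K) j (\<lambda>r. A r i)"
    by (auto simp: qct_def repl_row_def repl_col_def fun_eq_iff)
  then have "qct (repl_row ?K j (\<lambda>c. qct A i c)) = repl_col ?K j (\<lambda>r. A r i)"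
    by (simp add: qct_qmmul)
  then have num: "(\<Sum>\<alpha> | \<alpha> \<subseteq> {..<m} \<and> card \<alpha> = qrank m n A \<and> j \<in> \<alpha>.
      rdet_on \<alpha> j (repl_row ?K j (\<lambda>c. qct A i c))) = qcnj N"
    unfolding N_def qcnj_sum
    by (intro sum.cong refl) (auto simp: rdet_on_eq_qcnj_cdet_on finite_subset)
  have "X i j = qcnj (qct X j i)" by (simp add: qct_def)
  also have "\<dots> = qinv D * qcnj N" by (simp add: X qcnj_mult qcnj_qinv D_real)
  \<comment> \<open>Conjugation has reversed the two factors; \<open>D\<close> is real, so its
    inverse moves back to the right.\<close>
  also have "\<dots> = qcnj N * qinv D"
    unfolding D inverse_quat_def[symmetric] of_real_inverse[symmetric] by (rule of_real_quat_commute)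
  finally show "X i j =
      (\<Sum>\<alpha> | \<alpha> \<subseteq> {..<m} \<and> card \<alpha> = qrank m n A \<and> j \<in> \<alpha>.
          rdet_on \<alpha> j (repl_row ?K j (\<lambda>c. qct A i c))) * qinv ?D"
    unfolding num D_def .
qed

end
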